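(* There exists a discrete geometry predictor, i.e. a function $\hat G_1:\Lambda\times\Lambda\to\mathbb R$ such that for all $m,s\in\Lambda$ $$-\mathrm{Div}D\hat G_1(m,s)=\frac{-2\omega_2(s)}{|s|}\,\mathrm{Div}D\omega_2(m)$$ (with $\mathrm{Div}$ and $D$ acting in $m$) and $\hat G_1(\cdot,s)\in\dot{\mathcal H}^1$ for every $s\in\Lambda$. Moreover it admits a decomposition $$\hat G_1(m,s)=\hat G_1^m(m)\,\hat G_1^s(s),\qquad \hat G_1^s(s)=\frac{-2\omega_2(s)}{|s|},$$ where $\hat G_1^m\in\dot{\mathcal H}^1$ satisfies, for $i=0,1$ and every (arbitrarily small) $\delta>0$, $$|D^i\hat G_1^m(\ell)|\lesssim|\ell|^{-1/2-i+\delta}\qquad\text{for all }\ell\in\Lambda,$$ with a constant depending only on $\delta$.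
   Context: $\Lambda=\{m-(\tfrac12,\tfrac12): m\in\mathbb Z^2\}\subset\mathbb R^2$; $\Gamma_0=\{(x_1,0):x_1\le 0\}$; $\Gamma_\pm=\{m\in\Lambda: m_1<0,\ m_2=\pm\tfrac12\}$, $\Gamma=\Gamma_+\cup\Gamma_-$. $\mathcal R=\{e_1,e_2,-e_1,-e_2\}$; $\mathcal R(m)=\mathcal R$ if $m\notin\Gamma$ and $\mathcal R(m)=\mathcal R\setminus\{\mp e_2\}$ if $m\in\Gamma_\pm$. For $u:\Lambda\to\mathbb R$, $D_\rho u(m)=u(m+\rho)-u(m)$, and $Du(m)\in\mathbb R^{\mathcal R}$ has components $(Du(m))_\rho=D_\rho u(m)$ if $\rho\in\mathcal R(m)$ and $0$ otherwise; $D^0u=u$, $D^1u=Du$. For $g:\Lambda\to\mathbb R^{\mathcal R}$, $-\mathrm{Div}\,g(m)=\sum_{\rho\in\mathcal R}\big(g_\rho(m-\rho)-g_\rho(m)\big)$. $\dot{\mathcal H}^1=\{u:\Lambda\to\mathbb R: Du\in\ell^2(\Lambda)\}$. In polar coordinates $x=r(\cos\theta,\sin\theta)$, $\theta\in(-\pi,\pi)$, $\omega(x)=(\omega_1(x),\omega_2(x))=\sqrt r(\cos\tfrac\theta2,\sin\tfrac\theta2)$ on $\mathbb R^2\setminus\Gamma_0$ (so $\omega_2\notin\dot{\mathcal H}^1$ when restricted to $\Lambda$). $A\lesssim B$ means $A\le cB$ with a constant $c$ independent of the lattice points. *)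

theory Defs
  imports "HOL-Analysis.Analysis"
begin

text \<open>
  A function on the half_lattice is a total function on the plane of which only the values on
  \<open>half_lattice\<close> matter. The norm on \<^typ>\<open>real \<times> real\<close> is the Euclidean one.
\<close>

definition half_lattice :: "(real \<times> real) set" where
  "half_lattice = {(of_int a - 1/2, of_int b - 1/2) | a b :: int. True}"

definition crack :: "(real \<times> real) set" where
  "crack = {(x, 0) | x. x \<le> 0}"

definition Gamma_plus :: "(real \<times> real) set" where
  "Gamma_plus = {m \<in> half_lattice. fst m < 0 \<and> snd m = 1/2}"

definition Gamma_minus :: "(real \<times> real) set" where
  "Gamma_minus = {m \<in> half_lattice. fst m < 0 \<and> snd m = -1/2}"

definition dirs :: "(real \<times> real) set" where
  "dirs = {(1, 0), (0, 1), (-1, 0), (0, -1)}"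

definition dirs_at :: "real \<times> real \<Rightarrow> (real \<times> real) set" where
  "dirs_at m =
     (if m \<in> Gamma_plus then dirs - {(0, -1)}
      else if m \<in> Gamma_minus then dirs - {(0, 1)}
      else dirs)"

text \<open>A vector indexed by \<open>dirs\<close> is a function of the direction \<open>\<rho>\<close>, of which only
  the values on \<open>dirs\<close> matter; its Euclidean norm is \<open>L2_set _ dirs\<close>.\<close>

definition discrete_grad ::
  "(real \<times> real \<Rightarrow> real) \<Rightarrow> real \<times> real \<Rightarrow> real \<times> real \<Rightarrow> real" where
  "discrete_grad u m \<rho> = (if \<rho> \<in> dirs_at m then u (m + \<rho>) - u m else 0)"

definition discrete_div ::
  "(real \<times> real \<Rightarrow> real \<times> real \<Rightarrow> real) \<Rightarrow> real \<times> real \<Rightarrow> real" where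
  "discrete_div g m = - (\<Sum>\<rho>\<in>dirs. g (m - \<rho>) \<rho> - g m \<rho>)"

definition H1dot :: "(real \<times> real \<Rightarrow> real) set" where
  "H1dot = {u. (\<lambda>m. (L2_set (discrete_grad u m) dirs)\<^sup>2) summable_on half_lattice}"

text \<open>The modulus of \<open>D\<^sup>i u (m)\<close>; meaningful for \<open>i = 0\<close> and \<open>i = 1\<close> only.\<close>

definition norm_D :: "nat \<Rightarrow> (real \<times> real \<Rightarrow> real) \<Rightarrow> real \<times> real \<Rightarrow> real" where
  "norm_D i u m = (if i = 0 then \<bar>u m\<bar> else L2_set (discrete_grad u m) dirs)"

text \<open>\<^const>\<open>Arg\<close> takes values in \<open>(-\<pi>, \<pi>]\<close>, and in the open interval off \<^const>\<open>crack\<close>.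
  On the crack itself \<open>omega\<close> is a junk value.\<close>

definition omega :: "real \<times> real \<Rightarrow> real \<times> real" where
  "omega x = (let r = norm x; \<theta> = Arg (Complex (fst x) (snd x))
              in (sqrt r * cos (\<theta> / 2), sqrt r * sin (\<theta> / 2)))"

definition omega2 :: "real \<times> real \<Rightarrow> real" where
  "omega2 x = snd (omega x)"

lemma omega_polar:
  assumes "r > 0" "-pi < \<theta>" "\<theta> < pi"
  shows "omega (r * cos \<theta>, r * sin \<theta>) = (sqrt r * cos (\<theta> / 2), sqrt r * sin (\<theta> / 2))"
proof -
  have n: "norm (r * cos \<theta>, r * sin \<theta>) = r"
  proof -
    have "(r * cos \<theta>)\<^sup>2 + (r * sin \<theta>)\<^sup>2 = r\<^sup>2 * ((cos \<theta>)\<^sup>2 + (sin \<theta>)\<^sup>2)"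
      by (simp only: power_mult_distrib distrib_left)
    then show ?thesis using assms(1) by (simp add: norm_prod_def)
  qed
  have "Complex (r * cos \<theta>) (r * sin \<theta>) = rcis r \<theta>"
    by (simp add: complex_eq_iff)
  moreover have "Arg (rcis r \<theta>) = \<theta>"
    using assms by (intro cis_Arg_unique) (auto simp: rcis_def sgn_mult sgn_of_real sgn_cis)
  ultimately show ?thesis by (simp add: omega_def n)
qed

lemma half_lattice_off_crack: "half_lattice \<inter> crack = {}"
proof -
  have "real_of_int b - 1/2 \<noteq> 0" for b
  proof
    assume "real_of_int b - 1/2 = 0"
    then have "real_of_int (2 * b) = real_of_int 1" by simp
    then have "2 * b = 1" by (simp only: of_int_eq_iff)
    then show False by presburger
  qed
  then show ?thesis by (auto simp: half_lattice_def crack_def)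
qed

lemma half_lattice_closed:
  assumes "m \<in> half_lattice" "\<rho> \<in> dirs"
  shows "m + \<rho> \<in> half_lattice" "m - \<rho> \<in> half_lattice"
proof -
  have I: "(of_int a - 1/2, of_int b - 1/2) \<in> half_lattice" for a b :: int
    unfolding half_lattice_def by blast
  obtain a b :: int where m: "m = (of_int a - 1/2, of_int b - 1/2)"
    using assms(1) unfolding half_lattice_def by blast
  show "m + \<rho> \<in> half_lattice" "m - \<rho> \<in> half_lattice"
    using assms(2) I[of "a + 1" b] I[of "a - 1" b] I[of a "b + 1"] I[of a "b - 1"]
    by (auto simp: dirs_def m algebra_simps)
qed

definition discrete_geometry_predictor ::
  "(real \<times> real \<Rightarrow> real \<times> real \<Rightarrow> real) \<Rightarrow> bool" where
  "discrete_geometry_predictor G \<longleftrightarrow>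
     (\<forall>m\<in>half_lattice. \<forall>s\<in>half_lattice.
        - discrete_div (discrete_grad (\<lambda>l. G l s)) m
          = (-2 * omega2 s / norm s) * discrete_div (discrete_grad omega2) m) \<and>
     (\<forall>s\<in>half_lattice. (\<lambda>l. G l s) \<in> H1dot)"

end

theory Submission
  imports Defs
begin

text \<open>
  The corrector \<open>u\<close> is sought odd in the second variable, which turns the problem into a
  discrete Poisson equation \<open>L u = - L \<omega>\<^sub>2\<close> on the upper half-plane with a Neumann condition to the
  left and a Dirichlet condition to the right of the crack tip. Since \<open>\<omega>\<^sub>2\<close> is the imaginary part
  of the complex square root and has the correct symmetry across both parts of the axis, Taylor's
  formula gives \<open>L \<omega>\<^sub>2 = O(r\<^sup>-\<^sup>3)\<close>. For \<open>0 < \<alpha> < 1/2\<close> the function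
  \<open>Re ((-z)\<^sup>-\<^sup>\<alpha>) - 1/r\<close> is of size \<open>r\<^sup>-\<^sup>\<alpha>\<close> and a strict supersolution away from the tip. So the least
  solution exists and is \<open>O(r\<^sup>-\<^sup>\<alpha>)\<close> for every such \<open>\<alpha>\<close>. Its gradient is estimated by comparing \<open>u\<close>, suitably
  reflected across the axis, with its mirror image in the perpendicular bisector of a bond.
\<close>

section \<open>Interior gradient estimate\<close>

text \<open>The natural decaying mode of the mixed problem is Re ((-z)^(-1/2)). It suggests the rate
  1/2 but vanishes on the Dirichlet side, so it is no strict barrier. With \<alpha> < 1/2 the power
  stays positive on that side; this is where \<delta> is lost. The power is harmonic only in the
  continuum: on the lattice it leaves an error of order r^(-\<alpha>-4) and unknown sign. The term
  -1/r repairs this, because the plane Laplacian of 1/r is 1/r^3 > 0: the gain of order r^(-3) beats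
  the error and dominates the source. A single corrector must serve every \<delta>, while the
  barrier changes with \<alpha>. Hence the solution is built from infima over all supersolutions,
  without reference to one barrier, and is compared with each barrier afterwards.
  \<open>lap5\<close> and \<open>mixed_lap\<close> have the sign of minus the Laplacian. The index b
  stands for the height b - 1/2, so b to 1 - b is the reflection across the axis; the tip lies
  between the columns a = 0 and a = 1.\<close>

definition lap5 :: "(int \<Rightarrow> int \<Rightarrow> real) \<Rightarrow> int \<Rightarrow> int \<Rightarrow> real" where
  "lap5 u a b = 4 * u a b - u (a + 1) b - u (a - 1) b - u a (b + 1) - u a (b - 1)"

text \<open>The difference \<open>h\<close> of u and its mirror image is antisymmetric about the
  bisector. This supplies the missing boundary condition for a maximum principle on the half box 0
  \<le> i \<le> R, with a quadratic polynomial as barrier.\<close>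

lemma reflection_gradient_bound:
  fixes u :: "int \<Rightarrow> int \<Rightarrow> real" and R :: int and M F :: real
  assumes R: "R > 0"
    and M: "\<And>i j. \<bar>i\<bar> \<le> R + 1 \<Longrightarrow> \<bar>j\<bar> \<le> R \<Longrightarrow> \<bar>u i j\<bar> \<le> M"
    and F: "\<And>i j. \<bar>i\<bar> \<le> R \<Longrightarrow> \<bar>j\<bar> \<le> R \<Longrightarrow> \<bar>lap5 u i j\<bar> \<le> F"
  shows "\<bar>u 1 0 - u 0 0\<bar> \<le> 2 * M / R + R * F"
proof -
  have upper: "s * (u 1 0 - u 0 0) \<le> 2 * M / R + R * (F + e)"
    if s: "\<bar>s\<bar> = 1" and e: "e > 0" for s e :: real
  proof -
    define h where "h i j = s * (u (1 + i) j - u (- i) j)" for i j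
    \<comment> \<open>\<open>q\<close> has second difference -2, so \<open>q i + j^2\<close> is
      discrete harmonic; also \<open>q (-1) = - q 0\<close> and \<open>q R = R^2\<close>. Scaled by
      \<open>K\<close>, the harmonic part is at least 2M on the three outer sides, and
      \<open>(F + e) * q\<close> strictly beats the right-hand side of h, which is at most 2F. The
      bound at the origin comes from \<open>q 0 = R\<close>.\<close>
    define q where "q i = (2*i+1) * R - i^2 - i" for i
    define K where "K = 2 * M / R^2"
    define b where "b i j = (F + e) * q i + K * (q i + j^2)" for i j :: int
    define d where "d x = h (fst x) (snd x) - b (fst x) (snd x)" for x
    define B where "B = {0..R} \<times> {-R..R}"
    have Mpos: "M \<ge> 0" using M[of 0 0] R by auto
    have Fpos: "F \<ge> 0" using F[of 0 0] R by auto
    have lapb: "lap5 b i j = 2 * (F + e)" for i j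
      by (simp add: lap5_def b_def q_def algebra_simps power2_eq_square)
    have K: "K \<ge> 0" "K * R^2 = 2 * M" using R Mpos by (auto simp: K_def)
    have laph: "lap5 h i j \<le> 2 * F" if "0 \<le> i" "i < R" "\<bar>j\<bar> \<le> R" for i j
    proof -
      have "1 + (i + 1) = (1 + i) + 1" "1 + (i - 1) = (1 + i) - 1" "- (i + 1) = - i - 1" "- (i - 1) = - i + 1"
        by auto
      then have "lap5 h i j = s * (lap5 u (1 + i) j - lap5 u (- i) j)"
        by (simp only: lap5_def h_def) (simp add: algebra_simps)
      moreover have "\<bar>s * (lap5 u (1 + i) j - lap5 u (- i) j)\<bar> \<le> F + F"
        unfolding abs_mult s using F[of "1+i" j] F[of "-i" j] that by auto
      ultimately show ?thesis by linarith
    qed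
    have q: "0 \<le> q i" if "0 \<le> i" "i \<le> R" for i
    proof -
      have "0 \<le> i * (R - i) + (R - i) + i * R" using that by simp
      then show ?thesis by (simp add: q_def algebra_simps power2_eq_square)
    qed
    have hM: "h i j \<le> 2 * M" if "0 \<le> i" "i \<le> R" "\<bar>j\<bar> \<le> R" for i j
    proof -
      have "\<bar>s * (u (1 + i) j - u (- i) j)\<bar> \<le> M + M"
        unfolding abs_mult s using M[of "1+i" j] M[of "-i" j] that by auto
      then show ?thesis by (simp add: h_def)
    qed
    have bnd: "h i j \<le> b i j" if ij: "0 \<le> i" "i \<le> R" "\<bar>j\<bar> \<le> R" and "i = R \<or> \<bar>j\<bar> = R" for i j
    proof -
      have "R^2 \<le> q i + j^2"
      proof (cases "i = R")
        case True then show ?thesis by (simp add: q_def algebra_simps power2_eq_square)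
      next
        case False
        then have "j^2 = R^2" using that(4) by (metis power2_abs)
        then show ?thesis using q[OF ij(1,2)] by simp
      qed
      then have "real_of_int (R^2) \<le> real_of_int (q i + j^2)"
        by (simp only: of_int_le_iff)
      then have "K * real_of_int (R^2) \<le> K * real_of_int (q i + j^2)"
        by (rule mult_left_mono) (rule K)
      moreover have "0 \<le> (F + e) * real_of_int (q i)"
        using q[OF ij(1,2)] Fpos e by simp
      ultimately show ?thesis using hM[OF ij] K(2) by (simp add: b_def)
    qed
    have "finite B" "B \<noteq> {}" using R by (auto simp: B_def)
    then obtain x where xB: "x \<in> B" and xmax: "\<And>y. y \<in> B \<Longrightarrow> d y \<le> d x"
      using finite_imageI[of B d] Max_in[of "d ` B"] Max_ge[of "d ` B"]
      by (metis (no_types, lifting) empty_is_image image_eqI imageE)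
    obtain i j where x: "x = (i, j)" by (cases x)
    have ij: "0 \<le> i" "i \<le> R" "\<bar>j\<bar> \<le> R" using xB by (auto simp: B_def x)
    have "d x \<le> 0"
    proof (rule ccontr)
      assume pos: "\<not> d x \<le> 0"
      then have "\<not> (i = R \<or> \<bar>j\<bar> = R)" using bnd[of i j] ij by (auto simp: d_def x)
      then have int: "i < R" "\<bar>j\<bar> < R" using ij by auto
      have nb: "h i' j' - b i' j' \<le> h i j - b i j" if "0 \<le> i'" "i' \<le> R" "\<bar>j'\<bar> \<le> R" for i' j'
      proof -
        have "(i', j') \<in> B" using that unfolding B_def by (simp add: abs_le_iff)
        then show ?thesis using xmax[of "(i', j')"] by (simp add: d_def x)
      qed
      \<comment> \<open>For i = 0 the left neighbour lies outside the box. Antisymmetry of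
        \<open>h\<close> gives h - b there the value -(h - b)(0, j) - 2 K j^2, which is below the
        positive maximum.\<close>
      have left: "h (i - 1) j - b (i - 1) j \<le> h i j - b i j"
      proof (cases "i = 0")
        case True
        have "h (-1) j = - h 0 j" by (simp add: h_def algebra_simps)
        moreover have "b (-1) j + b 0 j = 2 * K * j^2"
          by (simp add: b_def q_def algebra_simps)
        moreover have "2 * K * j^2 \<ge> 0" using K by simp
        ultimately show ?thesis using pos True by (simp add: d_def x)
      next
        case False
        then show ?thesis using nb[of "i - 1" j] ij by auto
      qed
      have "\<bar>j + 1\<bar> \<le> R" "\<bar>j - 1\<bar> \<le> R" using int by linarith+
      then have "lap5 h i j - lap5 b i j \<ge> 0"
        using left nb[of "i+1" j] nb[of i "j+1"] nb[of i "j-1"] ij int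
        by (auto simp: lap5_def)
      then show False using laph[of i j] lapb ij int e by auto
    qed
    moreover have "d (0, 0) \<le> d x" using R by (intro xmax) (auto simp: B_def)
    ultimately have "h 0 0 \<le> b 0 0" by (simp add: d_def)
    then show ?thesis using R by (simp add: h_def b_def q_def K_def field_simps power2_eq_square)
  qed
  have "s * (u 1 0 - u 0 0) \<le> 2 * M / R + R * F" if s: "\<bar>s\<bar> = 1" for s
  proof (rule field_le_epsilon)
    fix e :: real assume "e > 0"
    then show "s * (u 1 0 - u 0 0) \<le> 2 * M / R + R * F + e"
      using upper[OF s, of "e / R"] R by (simp add: algebra_simps)
  qed
  from this[of 1] this[of "-1"] show ?thesis by auto
qed

section \<open>The mixed boundary value problem on the half-plane\<close>

text \<open>\<open>flip\<close> selects the odd reflection (Dirichlet condition); otherwise the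
  reflection is even, so that the difference across the axis is zero, as for a missing bond (Neumann
  condition).\<close>

definition half_ext :: "bool \<Rightarrow> (int \<Rightarrow> int \<Rightarrow> real) \<Rightarrow> int \<Rightarrow> int \<Rightarrow> real" where
  "half_ext flip u a b = (if b \<ge> 1 then u a b else if flip then - u a (1 - b) else u a (1 - b))"

text \<open>A stencil centred at b \<ge> 1 sees a reflected value only in its own column, so the
  kind of reflection may be chosen by the column of the centre.\<close>

definition mixed_lap :: "(int \<Rightarrow> int \<Rightarrow> real) \<Rightarrow> int \<Rightarrow> int \<Rightarrow> real" where
  "mixed_lap u a b = lap5 (half_ext (a \<ge> 1) u) a b"

lemma mixed_lap_eq:
  assumes "b \<ge> 1"
  shows "mixed_lap u a b = 4 * u a b - u (a + 1) b - u (a - 1) b - u a (b + 1)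
    - (if b \<noteq> 1 then u a (b - 1) else if a \<ge> 1 then - u a 1 else u a 1)"
  using assms by (auto simp: mixed_lap_def lap5_def half_ext_def)

lemma mixed_lap_diff:
  "mixed_lap (\<lambda>a b. u a b - v a b) a b = mixed_lap u a b - mixed_lap v a b"
  by (simp add: mixed_lap_def lap5_def half_ext_def)

lemma mixed_lap_cmult: "mixed_lap (\<lambda>a b. k * u a b) a b = k * mixed_lap u a b"
  by (simp add: mixed_lap_def lap5_def half_ext_def algebra_simps)

text \<open>Touching from below, the tool for gluing supersolutions by minima. For b = 1 the
  reflected neighbour is determined by the value at the centre, so nothing is required of
  it.\<close>

lemma mixed_lap_mono_at:
  assumes "b \<ge> 1" "w a b = u a b" "w (a + 1) b \<le> u (a + 1) b" "w (a - 1) b \<le> u (a - 1) b"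
    "w a (b + 1) \<le> u a (b + 1)" "b \<noteq> 1 \<Longrightarrow> w a (b - 1) \<le> u a (b - 1)"
  shows "mixed_lap u a b \<le> mixed_lap w a b"
  using assms by (auto simp: mixed_lap_eq)

definition supersolution :: "(int \<Rightarrow> int \<Rightarrow> real) \<Rightarrow> (int \<Rightarrow> int \<Rightarrow> real) \<Rightarrow> bool" where
  "supersolution f v \<longleftrightarrow> (\<forall>a b. b \<ge> 1 \<longrightarrow> 0 \<le> v a b \<and> f a b \<le> mixed_lap v a b)"

text \<open>Knaster--Tarski: \<open>u - mixed_lap u / 5\<close> is monotone in \<open>u\<close>, so the infimum of all
  supersolutions solves the equation.\<close>

lemma mixed_lap_minimal_solution:
  assumes f: "\<And>a b. b \<ge> 1 \<Longrightarrow> 0 \<le> f a b" and w: "supersolution f w"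
  shows "\<exists>G. (\<forall>a b. b \<ge> 1 \<longrightarrow> mixed_lap G a b = f a b \<and> 0 \<le> G a b)
    \<and> (\<forall>v a b. supersolution f v \<longrightarrow> b \<ge> 1 \<longrightarrow> G a b \<le> v a b)"
proof -
  define S where "S = {v. supersolution f v}"
  define G where "G a b = (INF v\<in>S. v a b)" for a b
  \<comment> \<open>The divisor 5 is the largest diagonal coefficient of \<open>mixed_lap\<close>:
    in the Dirichlet row the reflected value -u a 1 raises it from 4 to 5. It is what makes
    \<open>T\<close> monotone.\<close>
  define T where "T v a b = v a b - mixed_lap v a b / 5 + f a b / 5" for v a b
  have wS: "w \<in> S" using w by (simp add: S_def)
  have bdd: "bdd_below ((\<lambda>v. v a b) ` S)" if "b \<ge> 1" for a b
    using that by (intro bdd_belowI[of _ 0]) (auto simp: S_def supersolution_def)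
  have lower: "G a b \<le> v a b" if "v \<in> S" "b \<ge> 1" for v a b
    unfolding G_def using that bdd by (intro cINF_lower)
  have greatest: "c \<le> G a b" if "\<And>v. v \<in> S \<Longrightarrow> c \<le> v a b" for c a b
    unfolding G_def using that wS by (intro cINF_greatest) auto
  have mono: "T u a b \<le> T v a b" if le: "\<And>a b. b \<ge> 1 \<Longrightarrow> u a b \<le> v a b" and "b \<ge> 1" for u v a b
  proof -
    have "mixed_lap v a b - mixed_lap u a b \<le> 5 * (v a b - u a b)"
      using le[of b a] le[of b "a+1"] le[of b "a-1"] le[of "b+1" a] le[of "b-1" a] \<open>b \<ge> 1\<close>
      by (auto simp: mixed_lap_eq)
    then show ?thesis by (simp add: T_def)
  qed
  have nonneg: "G a b \<ge> 0" if "b \<ge> 1" for a b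
    using that by (intro greatest) (auto simp: S_def supersolution_def)
  have super: "T G a b \<le> G a b" if "b \<ge> 1" for a b
  proof (rule greatest)
    fix v assume v: "v \<in> S"
    have "T G a b \<le> T v a b" using lower[OF v] that by (rule mono)
    also have "\<dots> \<le> v a b" using v that by (simp add: S_def T_def supersolution_def)
    finally show "T G a b \<le> v a b" .
  qed
  have "T G \<in> S"
  proof -
    have "T (T G) a b \<le> T G a b" if "b \<ge> 1" for a b
      using super that by (rule mono)
    then have "f a b \<le> mixed_lap (T G) a b" if "b \<ge> 1" for a b
      using that by (fastforce simp: T_def[of "T G"])
    moreover have "0 \<le> T G a b" if "b \<ge> 1" for a b
    proof -
      have "T (\<lambda>_ _. 0) a b \<le> T G a b" using nonneg that by (rule mono)
      moreover have "T (\<lambda>_ _. 0) a b \<ge> 0" using f that by (simp add: T_def mixed_lap_eq)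
      ultimately show ?thesis by linarith
    qed
    ultimately show ?thesis by (simp add: S_def supersolution_def)
  qed
  then have "T G a b = G a b" if "b \<ge> 1" for a b
    using lower super that by (intro antisym) auto
  then have "mixed_lap G a b = f a b" if "b \<ge> 1" for a b
    using that by (fastforce simp: T_def)
  then show ?thesis using nonneg lower by (intro exI[of _ G]) (auto simp: S_def)
qed

text \<open>The minimal solutions for the positive and the negative part of f both lie between 0 and
  any supersolution v for the modulus of f, hence so does the modulus of their difference. The
  quantifier over v comes after G: one solution obeys all barriers.\<close>

lemma mixed_lap_solution:
  assumes "supersolution (\<lambda>a b. \<bar>f a b\<bar>) w"
  shows "\<exists>G. (\<forall>a b. b \<ge> 1 \<longrightarrow> mixed_lap G a b = f a b)
    \<and> (\<forall>v a b. supersolution (\<lambda>a b. \<bar>f a b\<bar>) v \<longrightarrow> b \<ge> 1 \<longrightarrow> \<bar>G a b\<bar> \<le> v a b)"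
proof -
  define p where "p a b = max (f a b) 0" for a b
  define n where "n a b = max (- f a b) 0" for a b
  have le: "supersolution p v \<and> supersolution n v" if "supersolution (\<lambda>a b. \<bar>f a b\<bar>) v" for v
  proof -
    have "0 \<le> v a b \<and> p a b \<le> mixed_lap v a b \<and> n a b \<le> mixed_lap v a b" if "b \<ge> 1" for a b
    proof -
      have "0 \<le> v a b" "\<bar>f a b\<bar> \<le> mixed_lap v a b"
        using \<open>supersolution (\<lambda>a b. \<bar>f a b\<bar>) v\<close> that by (auto simp: supersolution_def)
      then show ?thesis by (auto simp: p_def n_def)
    qed
    then show ?thesis by (simp add: supersolution_def)
  qed
  obtain Gp where Gp: "\<forall>a b. b \<ge> 1 \<longrightarrow> mixed_lap Gp a b = p a b \<and> 0 \<le> Gp a b"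
    "\<forall>v a b. supersolution p v \<longrightarrow> b \<ge> 1 \<longrightarrow> Gp a b \<le> v a b"
    using mixed_lap_minimal_solution[of p, OF _ le[OF assms, THEN conjunct1]] by (auto simp: p_def)
  obtain Gn where Gn: "\<forall>a b. b \<ge> 1 \<longrightarrow> mixed_lap Gn a b = n a b \<and> 0 \<le> Gn a b"
    "\<forall>v a b. supersolution n v \<longrightarrow> b \<ge> 1 \<longrightarrow> Gn a b \<le> v a b"
    using mixed_lap_minimal_solution[of n, OF _ le[OF assms, THEN conjunct2]] by (auto simp: n_def)
  have "mixed_lap (\<lambda>a b. Gp a b - Gn a b) a b = f a b" if "b \<ge> 1" for a b
    using that Gp(1) Gn(1) by (simp add: mixed_lap_diff p_def n_def)
  moreover have "\<bar>Gp a b - Gn a b\<bar> \<le> v a b" if "supersolution (\<lambda>a b. \<bar>f a b\<bar>) v" "b \<ge> 1" for v a b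
  proof -
    have "Gp a b \<le> v a b" "Gn a b \<le> v a b" "0 \<le> Gp a b" "0 \<le> Gn a b"
      using le[OF that(1)] that(2) Gp Gn by auto
    then show ?thesis by linarith
  qed
  ultimately show ?thesis by blast
qed

section \<open>The square root on the lattice\<close>

text \<open>Over d in {1, -1, \<i>, -\<i>} the sums of d, d^2 and d^3 vanish, so the Taylor
  expansion of the holomorphic power cancels through third order. The fourth derivative is of size
  |w|^(p-4).\<close>

lemma five_point_powr:
  fixes p :: real
  assumes p: "p \<le> 4"
  obtains C where "C \<ge> 0"
    "\<And>w. 2 \<le> cmod w \<Longrightarrow> cball w 1 \<inter> \<real>\<^sub>\<le>\<^sub>0 = {} \<Longrightarrow>
      cmod (4 * w powr p - (w + 1) powr p - (w - 1) powr p - (w + \<i>) powr p - (w - \<i>) powr p)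
      \<le> C * cmod w powr (p - 4)"
proof -
  define c where "c i = (\<Prod>j<i. complex_of_real p - of_nat j)" for i
  define f where "f i z = c i * z powr (of_real p - of_nat i)" for i z
  \<comment> \<open>The power of 2 pays for |z| \<ge> |w|/2 on the unit ball about w; p \<le> 4
    makes |z|^(p-4) nonincreasing in |z|.\<close>
  define C where "C = cmod (c 4) * 2 powr (4 - p)"
  show thesis
  proof (rule that[of C])
    show "C \<ge> 0" by (simp add: C_def)
    fix w :: complex
    assume w: "2 \<le> cmod w" and disj: "cball w 1 \<inter> \<real>\<^sub>\<le>\<^sub>0 = {}"
    have der: "(f i has_field_derivative f (Suc i) z) (at z within cball w 1)"
      if "z \<in> cball w 1" for i z
    proof -
      have "z \<notin> \<real>\<^sub>\<le>\<^sub>0" using disj that by auto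
      then have "((\<lambda>z. c i * z powr (of_real p - of_nat i)) has_field_derivative
          c i * ((of_real p - of_nat i) * z powr (of_real p - of_nat i - 1))) (at z within cball w 1)"
        by (intro DERIV_cmult has_field_derivative_at_within[OF has_field_derivative_powr])
      moreover have "f i = (\<lambda>z. c i * z powr (of_real p - of_nat i))"
        by (simp add: f_def fun_eq_iff)
      moreover have "f (Suc i) z = c i * ((of_real p - of_nat i) * z powr (of_real p - of_nat i - 1))"
        by (simp add: f_def c_def algebra_simps)
      ultimately show ?thesis by simp
    qed
    have bound: "cmod (f (Suc 3) z) \<le> C * cmod w powr (p - 4)" if "z \<in> cball w 1" for z
    proof -
      have "cmod w - cmod z \<le> 1"
        using that norm_triangle_ineq2[of w z] by (simp add: dist_norm)
      then have z: "cmod w / 2 \<le> cmod z" using w by simp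
      have "cmod (f 4 z) = cmod (c 4) * cmod (z powr of_real (p - 4))"
        by (simp add: f_def norm_mult)
      also have "cmod (z powr of_real (p - 4)) = cmod z powr (p - 4)"
        by (subst norm_powr_real_powr') auto
      also have "\<dots> \<le> (cmod w / 2) powr (p - 4)"
        using p w z by (intro powr_mono2') auto
      also have "\<dots> = 2 powr (4 - p) * cmod w powr (p - 4)"
        by (simp add: powr_divide powr_diff field_simps)
      finally show ?thesis by (simp add: C_def mult_left_mono mult.assoc eval_nat_numeral)
    qed
    define g where "g d = (w + d) powr p
      - (f 0 w + f 1 w * d + f 2 w * d^2 / 2 + f 3 w * d^3 / 6)" for d
    have g: "cmod (g d) \<le> C * cmod w powr (p - 4) / 6" if "cmod d = 1" for d
    proof -
      have "cmod (f 0 (w + d) - (\<Sum>i\<le>3. f i w * (w + d - w) ^ i / fact i))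
          \<le> C * cmod w powr (p - 4) * cmod (w + d - w) ^ Suc 3 / fact 3"
        using that by (intro complex_Taylor[OF convex_cball der bound]) (auto simp: dist_norm)
      then show ?thesis
        using that by (simp add: g_def f_def c_def eval_nat_numeral lessThan_Suc atMost_Suc fact_numeral algebra_simps)
    qed
    have "4 * w powr p - (w + 1) powr p - (w - 1) powr p - (w + \<i>) powr p - (w - \<i>) powr p
        = - (g 1 + g (-1) + g \<i> + g (-\<i>))"
      by (simp add: g_def f_def c_def power3_eq_cube algebra_simps)
    also have "cmod \<dots> \<le> cmod (g 1) + cmod (g (-1)) + cmod (g \<i>) + cmod (g (-\<i>))"
      by (simp only: norm_minus_cancel) (intro norm_triangle_mono order_refl)
    also have "\<dots> \<le> 4 * (C * cmod w powr (p - 4) / 6)"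
      using g[of 1] g[of "-1"] g[of \<i>] g[of "-\<i>"] by simp
    also have "\<dots> \<le> C * cmod w powr (p - 4)" using \<open>C \<ge> 0\<close> by simp
    finally show "cmod (4 * w powr p - (w + 1) powr p - (w - 1) powr p - (w + \<i>) powr p - (w - \<i>) powr p)
      \<le> C * cmod w powr (p - 4)" .
  qed
qed

section \<open>Lattice points as complex numbers, and powers cut along the positive axis\<close>

definition lattice_point :: "int \<Rightarrow> int \<Rightarrow> complex" where
  "lattice_point a b = Complex (a - 1/2) (b - 1/2)"

lemma lattice_point_shift:
  "lattice_point (a + 1) b = lattice_point a b + 1"
  "lattice_point (a - 1) b = lattice_point a b - 1"
  "lattice_point a (b + 1) = lattice_point a b + \<i>"
  "lattice_point a (b - 1) = lattice_point a b - \<i>"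
  by (auto simp: lattice_point_def complex_eq_iff)

lemma lattice_point_mirror: "lattice_point a (1 - b) = cnj (lattice_point a b)"
  by (simp add: lattice_point_def complex_eq_iff)

lemma Re_lattice_point [simp]: "Re (lattice_point a b) = a - 1/2"
  and Im_lattice_point [simp]: "Im (lattice_point a b) = b - 1/2"
  by (simp_all add: lattice_point_def)

lemma half_integer_nonzero: "real_of_int b - 1/2 \<noteq> 0"
proof
  assume "real_of_int b - 1/2 = 0"
  then have "real_of_int (2 * b) = real_of_int 1" by simp
  then have "2 * b = 1" by (simp only: of_int_eq_iff)
  then show False by presburger
qed

lemma Im_lattice_point_nonzero: "Im (lattice_point a b) \<noteq> 0"
  using half_integer_nonzero by simp

lemma lattice_point_nonzero [simp]: "lattice_point a b \<noteq> 0"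
  using Im_lattice_point_nonzero[of a b] by (metis zero_complex.simps(2))

text \<open>If Re w \<ge> 0, the nearest point of the slit is the origin, at distance at least 2;
  otherwise the imaginary part alone keeps w farther than 1 away.\<close>

lemma cball_avoids_slit:
  assumes "2 \<le> cmod w" "0 \<le> Re w \<or> 1 < \<bar>Im w\<bar>"
  shows "cball w 1 \<inter> \<real>\<^sub>\<le>\<^sub>0 = {}"
proof -
  have False if z: "cmod (w - z) \<le> 1" "z \<in> \<real>\<^sub>\<le>\<^sub>0" for z
  proof -
    obtain x where x: "z = complex_of_real x" "x \<le> 0" using z(2) by (auto elim: nonpos_Reals_cases)
    have "\<bar>Im w\<bar> \<le> cmod (w - z)" using abs_Im_le_cmod[of "w - z"] by (simp add: x)
    then have "0 \<le> Re w" using assms z by linarith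
    then have "(Re w)\<^sup>2 \<le> (Re w - x)\<^sup>2" using x by (intro power_mono) auto
    then have "(cmod w)\<^sup>2 \<le> (cmod (w - z))\<^sup>2" by (simp add: cmod_power2 x)
    then have "cmod w \<le> cmod (w - z)" by (rule power2_le_imp_le) simp
    then show False using z assms by linarith
  qed
  then show ?thesis by (auto simp: dist_norm)
qed

text \<open>The sign moves the branch cut to the positive axis. On the upper half-plane this is r^p
  cos (p (pi - \<theta>)), whose even reflection is smooth across the crack, as the Neumann
  condition asks.\<close>

definition slit_power :: "real \<Rightarrow> int \<Rightarrow> int \<Rightarrow> real" where
  "slit_power p a b = Re ((- lattice_point a b) powr p)"

lemma slit_power_mirror: "slit_power p a (1 - b) = slit_power p a b"
proof -
  have "cnj ((- lattice_point a b) powr p) = cnj (- lattice_point a b) powr cnj p"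
    using Im_lattice_point_nonzero by (intro cnj_powr) auto
  then have "Re (cnj (- lattice_point a b) powr p) = Re ((- lattice_point a b) powr p)"
    by (metis complex_cnj_complex_of_real complex_cnj cnj.simps(1))
  then show ?thesis by (simp add: slit_power_def lattice_point_mirror)
qed

text \<open>The condition \<open>a \<le> 0 \<or> b \<ge> 2\<close> keeps the unit ball about the
  point off the cut; in the row b = 1 right of the tip the stencil crosses it.\<close>

lemma lap5_slit_power:
  assumes "p \<le> 4"
  obtains C where "C \<ge> 0"
    "\<And>a b. 2 \<le> cmod (lattice_point a b) \<Longrightarrow> a \<le> 0 \<or> b \<ge> 2 \<Longrightarrow>
      \<bar>lap5 (slit_power p) a b\<bar> \<le> C * cmod (lattice_point a b) powr (p - 4)"
proof -
  obtain C where C: "C \<ge> 0"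
    "\<And>w. 2 \<le> cmod w \<Longrightarrow> cball w 1 \<inter> \<real>\<^sub>\<le>\<^sub>0 = {} \<Longrightarrow>
      cmod (4 * w powr p - (w + 1) powr p - (w - 1) powr p - (w + \<i>) powr p - (w - \<i>) powr p)
      \<le> C * cmod w powr (p - 4)"
    using five_point_powr[OF assms] by blast
  show thesis
  proof (rule that[OF C(1)])
    fix a b assume ab: "2 \<le> cmod (lattice_point a b)" "a \<le> 0 \<or> b \<ge> 2"
    define w where "w = - lattice_point a b"
    have "cball w 1 \<inter> \<real>\<^sub>\<le>\<^sub>0 = {}" using ab by (intro cball_avoids_slit) (auto simp: w_def)
    then have "cmod (4 * w powr p - (w + 1) powr p - (w - 1) powr p - (w + \<i>) powr p - (w - \<i>) powr p)
      \<le> C * cmod w powr (p - 4)" using ab by (intro C) (auto simp: w_def)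
    moreover have "- lattice_point (a + 1) b = w - 1" "- lattice_point (a - 1) b = w + 1"
      "- lattice_point a (b + 1) = w - \<i>" "- lattice_point a (b - 1) = w + \<i>" "- lattice_point a b = w"
      by (auto simp: w_def lattice_point_shift)
    then have "lap5 (slit_power p) a b
      = Re (4 * w powr p - (w + 1) powr p - (w - 1) powr p - (w + \<i>) powr p - (w - \<i>) powr p)"
      by (simp only: lap5_def slit_power_def) simp
    ultimately show "\<bar>lap5 (slit_power p) a b\<bar> \<le> C * cmod (lattice_point a b) powr (p - 4)"
      by (metis abs_Re_le_cmod norm_minus_cancel order_trans w_def)
  qed
qed

lemma omega2_eq: "omega2 (a - 1/2, b - 1/2) = Im (lattice_point a b powr (1/2 :: real))"
proof -
  define z where "z = lattice_point a b"
  have "z \<noteq> 0" by (simp add: z_def)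
  then have "Ln z = Complex (ln (cmod z)) (Arg z)" by (simp add: complex_eq_iff Arg_eq_Im_Ln)
  then have "Im (z powr (1/2 :: real)) = exp (ln (cmod z) / 2) * sin (Arg z / 2)"
    using \<open>z \<noteq> 0\<close> by (simp add: powr_def Im_exp)
  also have "exp (ln (cmod z) / 2) = sqrt (cmod z)"
    using \<open>z \<noteq> 0\<close> by (simp add: ln_sqrt[symmetric])
  finally show ?thesis
    by (simp add: omega2_def omega_def Let_def z_def lattice_point_def norm_prod_def cmod_def)
qed

definition omega_lat :: "int \<Rightarrow> int \<Rightarrow> real" where
  "omega_lat a b = omega2 (a - 1/2, b - 1/2)"

lemma omega_lat_mirror: "omega_lat a (1 - b) = - omega_lat a b"
proof -
  have "cnj (lattice_point a b powr (1/2 :: real)) = cnj (lattice_point a b) powr cnj (1/2 :: real)"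
    using Im_lattice_point_nonzero by (intro cnj_powr) auto
  then show ?thesis
    by (metis omega2_eq omega_lat_def lattice_point_mirror complex_cnj_complex_of_real cnj.simps(2))
qed

text \<open>In the upper half-plane (-z)^(1/2) = -\<i> z^(1/2). This rewrites \<omega>_2 by a branch
  that is smooth across the crack, where the principal branch jumps.\<close>

lemma omega_lat_eq_slit_power:
  assumes "b \<ge> 1"
  shows "omega_lat a b = slit_power (1/2) a b"
proof -
  define z where "z = lattice_point a b"
  have z: "z \<noteq> 0" "Im z > 0" using assms by (auto simp: z_def)
  have L: "Ln (- z) = Ln z - \<i> * pi" using z by (simp add: Ln_minus)
  have "(- z) powr (1/2 :: real) = exp (of_real (1/2) * Ln z + - (\<i> * pi / 2))"
    using z by (simp add: powr_def L diff_divide_distrib)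
  also have "\<dots> = z powr (1/2 :: real) * exp (- (\<i> * pi / 2))"
    unfolding exp_add using z by (simp add: powr_def)
  also have "exp (- (\<i> * pi / 2)) = - \<i>"
    by (simp add: complex_eq_iff Re_exp Im_exp)
  finally show ?thesis by (simp add: omega_lat_def slit_power_def omega2_eq z_def)
qed

lemma abs_omega_lat_le: "\<bar>omega_lat a b\<bar> \<le> sqrt (cmod (lattice_point a b))"
proof -
  have "\<bar>omega_lat a b\<bar> \<le> cmod (lattice_point a b powr of_real (1/2))"
    unfolding omega_lat_def omega2_eq by (rule abs_Im_le_cmod)
  also have "\<dots> = cmod (lattice_point a b) powr (1/2)"
    by (subst norm_powr_real_powr') auto
  finally show ?thesis by (simp add: powr_half_sqrt)
qed

lemma lap5_omega_lat:
  obtains C where "C \<ge> 0"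
    "\<And>a b. 2 \<le> cmod (lattice_point a b) \<Longrightarrow> a \<ge> 1 \<Longrightarrow>
      \<bar>lap5 omega_lat a b\<bar> \<le> C * cmod (lattice_point a b) powr (1/2 - 4)"
proof -
  obtain C where C: "C \<ge> 0"
    "\<And>w. 2 \<le> cmod w \<Longrightarrow> cball w 1 \<inter> \<real>\<^sub>\<le>\<^sub>0 = {} \<Longrightarrow>
      cmod (4 * w powr (1/2::real) - (w + 1) powr (1/2::real) - (w - 1) powr (1/2::real)
        - (w + \<i>) powr (1/2::real) - (w - \<i>) powr (1/2::real)) \<le> C * cmod w powr (1/2 - 4)"
    using five_point_powr[of "1/2"] by auto
  show thesis
  proof (rule that[OF C(1)])
    fix a b assume ab: "2 \<le> cmod (lattice_point a b)" "a \<ge> 1"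
    define w where "w = lattice_point a b"
    have "cball w 1 \<inter> \<real>\<^sub>\<le>\<^sub>0 = {}" using ab by (intro cball_avoids_slit) (auto simp: w_def)
    then have "cmod (4 * w powr (1/2::real) - (w + 1) powr (1/2::real) - (w - 1) powr (1/2::real)
        - (w + \<i>) powr (1/2::real) - (w - \<i>) powr (1/2::real)) \<le> C * cmod w powr (1/2 - 4)"
      using ab by (intro C) (auto simp: w_def)
    moreover have "lap5 omega_lat a b = Im (4 * w powr (1/2::real) - (w + 1) powr (1/2::real)
        - (w - 1) powr (1/2::real) - (w + \<i>) powr (1/2::real) - (w - \<i>) powr (1/2::real))"
      by (simp only: lap5_def omega_lat_def omega2_eq lattice_point_shift w_def) simp
    ultimately show "\<bar>lap5 omega_lat a b\<bar> \<le> C * cmod (lattice_point a b) powr (1/2 - 4)"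
      by (metis abs_Im_le_cmod order_trans w_def)
  qed
qed

lemma norm_lattice_point_shift:
  "\<bar>cmod (lattice_point (a + 1) b) - cmod (lattice_point a b)\<bar> \<le> 1"
  "\<bar>cmod (lattice_point (a - 1) b) - cmod (lattice_point a b)\<bar> \<le> 1"
  "\<bar>cmod (lattice_point a (b + 1)) - cmod (lattice_point a b)\<bar> \<le> 1"
  "\<bar>cmod (lattice_point a (b - 1)) - cmod (lattice_point a b)\<bar> \<le> 1"
  by (rule order_trans[OF norm_triangle_ineq3], simp add: lattice_point_shift)+

text \<open>The odd extension used right of the tip is \<omega>_2 itself, the even one used on the
  left is \<open>slit_power (1/2)\<close>; each branch is holomorphic around its stencils. The order
  r^(-7/2) so obtained is weakened to r^(-3) to match the barrier.\<close>

lemma mixed_lap_omega_lat: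
  obtains C where "C > 0"
    "\<And>a b. b \<ge> 1 \<Longrightarrow> \<bar>mixed_lap omega_lat a b\<bar> \<le> C / cmod (lattice_point a b) ^ 3"
proof -
  obtain C1 where C1: "C1 \<ge> 0" "\<And>a b. 2 \<le> cmod (lattice_point a b) \<Longrightarrow> a \<ge> 1 \<Longrightarrow>
      \<bar>lap5 omega_lat a b\<bar> \<le> C1 * cmod (lattice_point a b) powr (1/2 - 4)"
    using lap5_omega_lat by blast
  obtain C2 where C2: "C2 \<ge> 0" "\<And>a b. 2 \<le> cmod (lattice_point a b) \<Longrightarrow> a \<le> 0 \<or> b \<ge> 2 \<Longrightarrow>
      \<bar>lap5 (slit_power (1/2)) a b\<bar> \<le> C2 * cmod (lattice_point a b) powr (1/2 - 4)"
    using lap5_slit_power[of "1/2"] by auto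
  \<comment> \<open>128 = 16 * 8 covers r < 2: the values of \<omega>_2 in the stencil are at most
    2, with total weight at most 8, and r^3 < 8.\<close>
  show thesis
  proof (rule that[of "128 + C1 + C2"])
    show "128 + C1 + C2 > 0" using C1 C2 by simp
    fix a b :: int assume b: "b \<ge> 1"
    define r where "r = cmod (lattice_point a b)"
    have r: "r > 0" by (simp add: r_def)
    show "\<bar>mixed_lap omega_lat a b\<bar> \<le> (128 + C1 + C2) / cmod (lattice_point a b) ^ 3"
    proof (cases "r < 2")
      case True
      have o: "\<bar>omega_lat a' b'\<bar> \<le> 2" if "cmod (lattice_point a' b') \<le> r + 1" for a' b'
      proof -
        have "sqrt (cmod (lattice_point a' b')) \<le> sqrt (2^2)"
          using that True by (intro real_sqrt_le_mono) simp
        then show ?thesis using abs_omega_lat_le[of a' b'] by simp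
      qed
      have "cmod (lattice_point (a + 1) b) \<le> r + 1" "cmod (lattice_point (a - 1) b) \<le> r + 1"
        "cmod (lattice_point a (b + 1)) \<le> r + 1" "cmod (lattice_point a (b - 1)) \<le> r + 1"
        using norm_lattice_point_shift[of a b] unfolding r_def by linarith+
      then have "\<bar>mixed_lap omega_lat a b\<bar> \<le> 16"
        using o[of a b] o[of "a+1" b] o[of "a-1" b] o[of a "b+1"] o[of a "b-1"] b
        by (auto simp: mixed_lap_eq r_def)
      also have "\<dots> \<le> 128 / r ^ 3"
        using power_mono[of r 2 3] True r by (simp add: pos_le_divide_eq)
      also have "\<dots> \<le> (128 + C1 + C2) / r ^ 3" using C1 C2 r by (simp add: divide_right_mono)
      finally show ?thesis by (simp add: r_def)
    next
      case False
      have "\<bar>mixed_lap omega_lat a b\<bar> \<le> (128 + C1 + C2) * r powr (1/2 - 4)"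
      proof (cases "a \<ge> 1")
        case True
        have "half_ext True omega_lat = omega_lat"
          by (auto simp: half_ext_def omega_lat_mirror fun_eq_iff)
        then have "mixed_lap omega_lat a b = lap5 omega_lat a b" using True by (simp add: mixed_lap_def)
        also have "\<bar>\<dots>\<bar> \<le> C1 * r powr (1/2 - 4)" using C1(2)[of a b] False True by (simp add: r_def)
        also have "\<dots> \<le> (128 + C1 + C2) * r powr (1/2 - 4)"
          using C2 by (intro mult_right_mono) auto
        finally show ?thesis .
      next
        case neg: False
        have "half_ext False omega_lat = slit_power (1/2)"
          using omega_lat_eq_slit_power
          by (auto simp: half_ext_def slit_power_mirror fun_eq_iff)
        then have "mixed_lap omega_lat a b = lap5 (slit_power (1/2)) a b"
          using neg by (simp add: mixed_lap_def)
        also have "\<bar>\<dots>\<bar> \<le> C2 * r powr (1/2 - 4)" using C2(2)[of a b] False neg by (simp add: r_def)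
        also have "\<dots> \<le> (128 + C1 + C2) * r powr (1/2 - 4)"
          using C1 by (intro mult_right_mono) auto
        finally show ?thesis .
      qed
      also have "r powr (1/2 - 4) \<le> r powr (- 3)" using False by (intro powr_mono) auto
      also have "r powr (- 3) = 1 / r ^ 3" using r powr_minus_divide[of r 3] by simp
      finally show ?thesis using C1 C2 by (simp add: r_def)
    qed
  qed
qed

section \<open>Supersolutions\<close>

text \<open>The left side is the cubic Taylor polynomial q of (1 + d)^(-1/2). Squaring reduces the
  claim to q^2 (1 + d) \<le> 1, where the deficit is d^4 times a cubic that is positive on this
  range.\<close>

lemma cubic_le_inverse_sqrt:
  fixes d :: real
  assumes "-1 < d" "d \<le> 1"
  shows "1 - d/2 + 3 * d^2 / 8 - 5 * d^3 / 16 \<le> 1 / sqrt (1 + d)"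
proof -
  define q where "q = 1 - d/2 + 3 * d^2 / 8 - 5 * d^3 / 16"
  have "q^2 * (1 + d) = 1 - d^4 * (140 - 56 * d + 35 * d^2 - 25 * d^3) / 256"
    unfolding q_def by algebra
  moreover have "0 \<le> d^4 * (140 - 56 * d + 35 * d^2 - 25 * d^3)"
  proof -
    have "d^3 \<le> 1"
    proof (cases "d \<ge> 0")
      case True then show ?thesis using assms by (intro power_le_one)
    next
      case False
      then have "d^2 * d \<le> 0" by (intro mult_nonneg_nonpos) auto
      then show ?thesis by (simp add: power3_eq_cube power2_eq_square)
    qed
    moreover have "0 \<le> d^2" by simp
    ultimately have "0 \<le> 140 - 56 * d + 35 * d^2 - 25 * d^3" using assms by linarith
    then show ?thesis by simp
  qed
  ultimately have "q^2 * (1 + d) \<le> 1" by simp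
  then have "q^2 \<le> (1 / sqrt (1 + d))^2"
    using assms by (simp add: power_divide pos_le_divide_eq)
  then have "q \<le> 1 / sqrt (1 + d)"
    by (rule power2_le_imp_le) (use assms in simp)
  then show ?thesis by (simp add: q_def)
qed

text \<open>The continuous value is -1/r^3; half of it is given away to the discretisation error.
  Each neighbour has squared norm r^2 (1 + t) with t = (1 + 2c)/r^2 and c one of x, -x, y, -y, so
  the cubic lower bound for 1/sqrt (1 + t) applies.\<close>

lemma lap5_inverse_norm:
  assumes r: "4 \<le> cmod (lattice_point a b)"
  shows "lap5 (\<lambda>a b. 1 / cmod (lattice_point a b)) a b \<le> - 1 / (2 * cmod (lattice_point a b) ^ 3)"
proof -
  define z where "z = lattice_point a b"
  define x where "x = Re z"
  define y where "y = Im z"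
  define r where "r = cmod z"
  define s where "s = 1 / r^2"
  define q :: "real \<Rightarrow> real" where "q d = 1 - d/2 + 3 * d^2 / 8 - 5 * d^3 / 16" for d
  have r4: "4 \<le> r" using r by (simp add: r_def z_def)
  have r2: "r^2 = x^2 + y^2" by (simp add: r_def x_def y_def cmod_power2)
  have s: "s > 0" "(x^2 + y^2) * s = 1" "s \<le> 1/16"
    using r4 power_mono[of 4 r 2] by (auto simp: s_def r2[symmetric] field_simps)
  have nb: "q ((1 + 2 * c) * s) / r \<le> 1 / cmod z'"
    if z': "(cmod z')^2 = r^2 + (1 + 2 * c)" and c: "\<bar>c\<bar> \<le> r" for z' c
  proof -
    have "1 + 2 * r \<le> r^2 - 7"
      using mult_right_mono[of 4 r r] r4 unfolding power2_eq_square by linarith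
    then have d: "- 1 < (1 + 2 * c) * s" "(1 + 2 * c) * s \<le> 1"
      using c r4 by (auto simp: s_def field_simps)
    define t where "t = (1 + 2 * c) * s"
    have t: "- 1 < t" "t \<le> 1" using d by (auto simp: t_def)
    have "(cmod z')^2 = r^2 * (1 + t)"
      using r4 by (simp add: z' t_def s_def field_simps)
    also have "\<dots> = (r * sqrt (1 + t))^2"
      using t by (simp add: power_mult_distrib)
    finally have "cmod z' = r * sqrt (1 + t)"
      by (rule power2_eq_imp_eq) (use r4 t in simp_all)
    then have "1 / cmod z' = (1 / sqrt (1 + t)) / r" by simp
    moreover have "q t \<le> 1 / sqrt (1 + t)"
      unfolding q_def using t by (rule cubic_le_inverse_sqrt)
    then have "q t / r \<le> (1 / sqrt (1 + t)) / r" using r4 by (intro divide_right_mono) auto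
    ultimately show ?thesis by (simp only: t_def)
  qed
  have xy: "\<bar>x\<bar> \<le> r" "\<bar>y\<bar> \<le> r"
    unfolding x_def y_def r_def by (rule abs_Re_le_cmod abs_Im_le_cmod)+
  have sq: "(cmod (z + 1))^2 = r^2 + (1 + 2 * x)" "(cmod (z - 1))^2 = r^2 + (1 + 2 * (- x))"
    "(cmod (z + \<i>))^2 = r^2 + (1 + 2 * y)" "(cmod (z - \<i>))^2 = r^2 + (1 + 2 * (- y))"
    unfolding r2 cmod_power2 by (simp_all add: x_def y_def power2_sum power2_diff)
  have le1: "q ((1 + 2 * x) * s) / r \<le> 1 / cmod (z + 1)" by (rule nb[OF sq(1) xy(1)])
  have le2: "q ((1 + 2 * (- x)) * s) / r \<le> 1 / cmod (z - 1)"
    by (rule nb[OF sq(2)]) (use xy in simp)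
  have le3: "q ((1 + 2 * y) * s) / r \<le> 1 / cmod (z + \<i>)" by (rule nb[OF sq(3) xy(2)])
  have le4: "q ((1 + 2 * (- y)) * s) / r \<le> 1 / cmod (z - \<i>)"
    by (rule nb[OF sq(4)]) (use xy in simp)
  \<comment> \<open>Opposite neighbours cancel the odd powers of x and y; the rest depends on x^2 +
    y^2 only. The surplus s yields -1/r^3, and s \<le> 1/16 bounds the remaining terms by
    s/2.\<close>
  have "q ((1 + 2 * x) * s) + q ((1 + 2 * (- x)) * s) + q ((1 + 2 * y) * s) + q ((1 + 2 * (- y)) * s)
      = 4 - 2 * s + 3/8 * (4 * s^2 + 8 * s * ((x^2 + y^2) * s))
        - 5/16 * (4 * s^3 + 24 * s^2 * ((x^2 + y^2) * s))"
    unfolding q_def by (simp add: power2_eq_square power3_eq_cube field_simps)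
  also have "\<dots> = 4 + s - 6 * s^2 - 5/4 * s^3"
    unfolding s(2) by (simp add: field_simps)
  finally have sum: "q ((1 + 2 * x) * s) + q ((1 + 2 * (- x)) * s) + q ((1 + 2 * y) * s)
    + q ((1 + 2 * (- y)) * s) = 4 + s - 6 * s^2 - 5/4 * s^3" .
  have "q ((1 + 2 * x) * s) / r + q ((1 + 2 * (- x)) * s) / r + q ((1 + 2 * y) * s) / r
      + q ((1 + 2 * (- y)) * s) / r = (4 + s - 6 * s^2 - 5/4 * s^3) / r"
    unfolding add_divide_distrib[symmetric] sum ..
  with le1 le2 le3 le4
  have "lap5 (\<lambda>a b. 1 / cmod (lattice_point a b)) a b \<le> 4 / r - (4 + s - 6 * s^2 - 5/4 * s^3) / r"
    unfolding lap5_def lattice_point_shift z_def[symmetric] r_def[symmetric] by linarith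
  also have "\<dots> = - (s - 6 * s^2 - 5/4 * s^3) / r"
    unfolding diff_divide_distrib[symmetric] by simp
  also have "\<dots> \<le> - (s / 2) / r"
  proof (rule divide_right_mono)
    have "s * s \<le> s * (1/16)" "s * (s * s) \<le> s * (s * (1/16))"
      using s(1,3) by (auto intro: mult_left_mono)
    then have "s^2 \<le> s / 16" "s^3 \<le> s^2 / 16"
      by (auto simp: power2_eq_square power3_eq_cube mult.assoc)
    then show "- (s - 6 * s^2 - 5/4 * s^3) \<le> - (s / 2)" using s(1) by linarith
  qed (use r4 in simp)
  also have "\<dots> = - 1 / (2 * r^3)"
    by (simp add: s_def power2_eq_square power3_eq_cube)
  finally show ?thesis by (simp add: r_def z_def)
qed

text \<open>A first-order bound that holds also in the row next to the cut, where the Taylor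
  estimate fails.\<close>

lemma slit_power_lipschitz:
  assumes al: "0 < \<alpha>" "\<alpha> < 1" and b: "b \<ge> 1" "b' \<ge> 1" and r: "2 \<le> cmod (lattice_point a b)"
    and near: "cmod (lattice_point a' b' - lattice_point a b) \<le> 1"
  shows "\<bar>slit_power (- \<alpha>) a' b' - slit_power (- \<alpha>) a b\<bar> \<le> 2 / cmod (lattice_point a b)"
proof -
  define w where "w = - lattice_point a b"
  define w' where "w' = - lattice_point a' b'"
  define p where "p = complex_of_real (- \<alpha>)"
  \<comment> \<open>The unit ball may meet the cut; intersecting it with a half-plane keeps it
    convex and off the cut, and both points lie there because b and b' are at least 1.\<close>
  define S where "S = cball w 1 \<inter> {z. Im z \<le> - 1/2}"
  have S: "convex S" "w \<in> S" "w' \<in> S"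
    using near b by (auto simp: S_def w_def w'_def dist_norm norm_minus_commute
      intro!: convex_Int convex_cball convex_halfspace_Im_le)
  have "cmod (w' powr p - w powr p) \<le> 2 / cmod w * cmod (w' - w)"
  proof (rule field_differentiable_bound[OF S(1)])
    fix z assume z: "z \<in> S"
    have "z \<notin> \<real>\<^sub>\<le>\<^sub>0" using z by (auto simp: S_def elim: nonpos_Reals_cases)
    then show "((\<lambda>z. z powr p) has_field_derivative p * z powr (p - 1)) (at z within S)"
      by (intro has_field_derivative_at_within[OF has_field_derivative_powr])
    have "cmod w - cmod z \<le> 1"
      using z norm_triangle_ineq2[of w z] by (simp add: dist_norm S_def)
    then have zw: "cmod w / 2 \<le> cmod z" "1 \<le> cmod z" using r by (auto simp: w_def)
    have "cmod (p * z powr (p - 1)) = \<alpha> * cmod (z powr of_real (- \<alpha> - 1))"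
      using al by (simp add: norm_mult p_def)
    also have "cmod (z powr of_real (- \<alpha> - 1)) = cmod z powr (- \<alpha> - 1)"
      by (subst norm_powr_real_powr') auto
    also have "\<alpha> * cmod z powr (- \<alpha> - 1) \<le> 1 * cmod z powr (- 1)"
      using zw al by (intro mult_mono powr_mono) auto
    also have "\<dots> = 1 / cmod z" using zw powr_minus_divide[of "cmod z" 1] by simp
    also have "\<dots> \<le> 1 / (cmod w / 2)" using zw r by (intro divide_left_mono mult_pos_pos) (auto simp: w_def)
    finally show "cmod (p * z powr (p - 1)) \<le> 2 / cmod w" by simp
  qed (use S in auto)
  also have "\<dots> \<le> 2 / cmod w * 1"
    using near by (intro mult_left_mono) (auto simp: w_def w'_def norm_minus_commute)
  finally have "cmod (w' powr p - w powr p) \<le> 2 / cmod (lattice_point a b)" by (simp add: w_def)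
  moreover have "slit_power (- \<alpha>) a' b' - slit_power (- \<alpha>) a b = Re (w' powr p - w powr p)"
    by (simp add: slit_power_def w_def w'_def p_def)
  ultimately show ?thesis by (metis abs_Re_le_cmod order_trans)
qed

text \<open>The argument of -z has modulus at most pi, and \<alpha> < 1/2 makes the factor cos
  (\<alpha> pi) positive.\<close>

lemma slit_power_bounds:
  assumes "0 < \<alpha>" "\<alpha> < 1/2"
  shows "cos (\<alpha> * pi) * cmod (lattice_point a b) powr (- \<alpha>) \<le> slit_power (- \<alpha>) a b"
    "slit_power (- \<alpha>) a b \<le> cmod (lattice_point a b) powr (- \<alpha>)"
proof -
  define w where "w = - lattice_point a b"
  have w: "w \<noteq> 0" by (simp add: w_def)
  have "Re (w powr of_real (- \<alpha>)) = cmod w powr (- \<alpha>) * cos (\<alpha> * Im (Ln w))"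
    using w by (simp add: powr_def Re_exp)
  then have eq: "slit_power (- \<alpha>) a b = cmod (lattice_point a b) powr (- \<alpha>) * cos (\<alpha> * Im (Ln w))"
    by (simp add: slit_power_def w_def)
  have "\<bar>Im (Ln w)\<bar> \<le> pi" using Im_Ln_le_pi[OF w] mpi_less_Im_Ln[OF w] by simp
  then have "\<alpha> * \<bar>Im (Ln w)\<bar> \<le> \<alpha> * pi" using assms by simp
  then have "cos (\<alpha> * pi) \<le> cos (\<alpha> * \<bar>Im (Ln w)\<bar>)"
    using assms by (intro cos_monotone_0_pi_le) auto
  also have "\<dots> = cos (\<alpha> * Im (Ln w))" by (simp add: abs_if)
  finally have "cos (\<alpha> * pi) \<le> cos (\<alpha> * Im (Ln w))" .
  then show "cos (\<alpha> * pi) * cmod (lattice_point a b) powr (- \<alpha>) \<le> slit_power (- \<alpha>) a b"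
    by (simp add: eq mult.commute mult_left_mono)
  show "slit_power (- \<alpha>) a b \<le> cmod (lattice_point a b) powr (- \<alpha>)"
    unfolding eq by (intro mult_left_le) auto
qed

text \<open>Evenness is the Neumann reflection. In the Dirichlet row the neighbour u a 1 is replaced
  by its negative, which adds 2 u, a gain whenever u is positive.\<close>

lemma mixed_lap_even:
  assumes "\<And>a b. u a (1 - b) = u a b" "b \<ge> 1"
  shows "mixed_lap u a b = lap5 u a b + (if a \<ge> 1 \<and> b = 1 then 2 * u a b else 0)"
  using assms(1)[of a 1] assms(2) by (auto simp: mixed_lap_eq lap5_def)

definition barrier :: "real \<Rightarrow> int \<Rightarrow> int \<Rightarrow> real" where
  "barrier \<alpha> a b = slit_power (- \<alpha>) a b - 1 / cmod (lattice_point a b)"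

lemma barrier_mirror: "barrier \<alpha> a (1 - b) = barrier \<alpha> a b"
  by (simp add: barrier_def slit_power_mirror) (simp add: lattice_point_mirror)

text \<open>Off the cut the gain 1/(2 r^3) from -1/r absorbs the Taylor error. In the Dirichlet row
  the diagonal 5 against three neighbours leaves about 2 r^(-\<alpha>), up to a factor, against
  losses of order 1/r.\<close>

lemma barrier_far:
  assumes al: "0 < \<alpha>" "\<alpha> < 1/2"
  obtains R0 \<kappa> where "R0 \<ge> 4" "0 < \<kappa>" "\<kappa> \<le> 1"
    "\<And>a b. b \<ge> 1 \<Longrightarrow> R0 \<le> cmod (lattice_point a b) \<Longrightarrow>
      \<kappa> * cmod (lattice_point a b) powr (- \<alpha>) \<le> barrier \<alpha> a b \<and>
      barrier \<alpha> a b \<le> cmod (lattice_point a b) powr (- \<alpha>) \<and>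
      1 / (4 * cmod (lattice_point a b) ^ 3) \<le> mixed_lap (barrier \<alpha>) a b"
proof -
  define k where "k = cos (\<alpha> * pi)"
  have k: "0 < k" "k \<le> 1" using al by (auto simp: k_def intro!: cos_gt_zero)
  obtain C where C: "C \<ge> 0"
    "\<And>a b. 2 \<le> cmod (lattice_point a b) \<Longrightarrow> a \<le> 0 \<or> b \<ge> 2 \<Longrightarrow>
      \<bar>lap5 (slit_power (- \<alpha>)) a b\<bar> \<le> C * cmod (lattice_point a b) powr (- \<alpha> - 4)"
    using lap5_slit_power[of "- \<alpha>"] al by auto
  \<comment> \<open>4 is needed for \<open>lap5_inverse_norm\<close>, 4C makes the Taylor error at
    most 1/(4 r^3), and (12/k)^2 gives 12/r \<le> k r^(-\<alpha>). The 12 covers the loss 11/r = 5/r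
    + 6/r of the Dirichlet row.\<close>
  define R0 where "R0 = 4 + 4 * C + (12 / k)^2"
  show thesis
  proof (rule that[of R0 "k/2"])
    show "R0 \<ge> 4" "0 < k/2" "k/2 \<le> 1" using C k by (auto simp: R0_def)
    fix a b :: int assume b: "b \<ge> 1" and R0: "R0 \<le> cmod (lattice_point a b)"
    define r where "r = cmod (lattice_point a b)"
    define h where "h a b = slit_power (- \<alpha>) a b" for a b
    have r: "4 \<le> r" "4 * C \<le> r" "(12 / k)^2 \<le> r"
      using R0 C zero_le_power2[of "12 / k"] unfolding R0_def r_def by linarith+
    have h: "k * r powr (- \<alpha>) \<le> h a b" "h a b \<le> r powr (- \<alpha>)"
      using slit_power_bounds[OF al] by (auto simp: h_def k_def r_def)
    have "12 / k \<le> sqrt r" using r k by (intro real_le_rsqrt)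
    then have "12 \<le> k * sqrt r" using k by (simp add: field_simps)
    then have "12 / r \<le> k * sqrt r / r" using r by (intro divide_right_mono) auto
    also have "\<dots> = k * r powr (- 1/2)"
    proof -
      have "r powr (- 1/2) = inverse (sqrt r)"
        using r powr_minus[of r "1/2"] by (simp add: powr_half_sqrt)
      moreover have "sqrt r / r = inverse (sqrt r)" using r by (intro sqrt_divide_self_eq) simp
      ultimately show ?thesis by (metis times_divide_eq_right)
    qed
    also have "\<dots> \<le> k * r powr (- \<alpha>)" using k r al by (intro mult_left_mono powr_mono) auto
    finally have twelve: "12 / r \<le> k * r powr (- \<alpha>)" .
    have v: "barrier \<alpha> a b = h a b - 1 / r" by (simp add: barrier_def h_def r_def)
    have "1 / r \<le> k * r powr (- \<alpha>) / 2" using twelve r by (simp add: field_simps)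
    then have lower: "k/2 * r powr (- \<alpha>) \<le> barrier \<alpha> a b" using h v by simp
    have upper: "barrier \<alpha> a b \<le> r powr (- \<alpha>)" 
    proof -
      have "0 \<le> 1 / r" using r by simp
      then show ?thesis using h(2) v by linarith
    qed
    have "1 / (4 * r^3) \<le> mixed_lap (barrier \<alpha>) a b"
    proof (cases "a \<le> 0 \<or> b \<ge> 2")
      case True
      have "mixed_lap (barrier \<alpha>) a b = lap5 (barrier \<alpha>) a b"
        using True b by (auto simp: mixed_lap_even[of "barrier \<alpha>", OF barrier_mirror])
      also have "\<dots> = lap5 h a b - lap5 (\<lambda>a b. 1 / cmod (lattice_point a b)) a b"
        by (simp add: lap5_def barrier_def h_def)
      finally have eq: "mixed_lap (barrier \<alpha>) a b = lap5 h a b - lap5 (\<lambda>a b. 1 / cmod (lattice_point a b)) a b" .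
      have "\<bar>lap5 h a b\<bar> \<le> C * r powr (- \<alpha> - 4)"
        using C(2)[of a b] True r by (simp add: h_def[abs_def] r_def)
      also have "\<dots> \<le> C * r powr (- 4)" using C r al by (intro mult_left_mono powr_mono) auto
      also have "r powr (- 4) = 1 / r^4" using r powr_minus_divide[of r 4] by simp
      also have "C * (1 / r^4) = 4 * C / r * (1 / (4 * r^3))"
        using r by (simp add: power_numeral_reduce)
      also have "\<dots> \<le> 1 * (1 / (4 * r^3))"
        using r C by (intro mult_right_mono) auto
      finally have "\<bar>lap5 h a b\<bar> \<le> 1 / (4 * r^3)" by simp
      moreover have "lap5 (\<lambda>a b. 1 / cmod (lattice_point a b)) a b \<le> - 1 / (2 * r^3)"
        unfolding r_def using r by (intro lap5_inverse_norm) (simp add: r_def)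
      moreover have "- 1 / (2 * r^3) = - 2 * (1 / (4 * r^3))" by simp
      ultimately show ?thesis unfolding eq by linarith
    next
      case False
      then have ab: "a \<ge> 1" "b = 1" using b by auto
      have nb: "barrier \<alpha> a' b' \<le> h a b + 2 / r"
        if "cmod (lattice_point a' b' - lattice_point a b) \<le> 1" "b' \<ge> 1" for a' b'
      proof -
        have "\<bar>h a' b' - h a b\<bar> \<le> 2 / r"
          unfolding h_def r_def using that al b r by (intro slit_power_lipschitz) (auto simp: r_def)
        moreover have "barrier \<alpha> a' b' \<le> h a' b'" by (simp add: barrier_def h_def)
        ultimately show ?thesis by linarith
      qed
      have "mixed_lap (barrier \<alpha>) a b = 5 * (h a b - 1/r) - barrier \<alpha> (a + 1) b - barrier \<alpha> (a - 1) b - barrier \<alpha> a (b + 1)"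
        using ab v by (simp add: mixed_lap_eq)
      also have "\<dots> \<ge> 5 * (h a b - 1/r) - 3 * (h a b + 2 / r)"
        using nb[of "a+1" b] nb[of "a-1" b] nb[of a "b+1"] b by (simp add: lattice_point_shift)
      finally have "2 * h a b - 11 * (1 / r) \<le> mixed_lap (barrier \<alpha>) a b" by simp
      moreover have "12 * (1 / r) \<le> h a b" using twelve h by simp
      moreover have "1 / (4 * r^3) \<le> 1 / r"
        using r power_increasing[of 1 3 r] by (intro divide_left_mono) auto
      moreover have "0 \<le> 1 / r" using r by simp
      ultimately show ?thesis by linarith
    qed
    with lower upper show "k/2 * cmod (lattice_point a b) powr (- \<alpha>) \<le> barrier \<alpha> a b \<and>
      barrier \<alpha> a b \<le> cmod (lattice_point a b) powr (- \<alpha>) \<and>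
      1 / (4 * cmod (lattice_point a b) ^ 3) \<le> mixed_lap (barrier \<alpha>) a b"
      by (simp add: r_def)
  qed
qed

lemma norm_lattice_point_ge_half: "1/2 \<le> cmod (lattice_point a b)"
proof -
  have "1/2 \<le> \<bar>Im (lattice_point a b)\<bar>"
    by (cases "b \<ge> 1") auto
  then show ?thesis using abs_Im_le_cmod order_trans by blast
qed

text \<open>The barrier fails to be a supersolution near the origin, where it is replaced by the minimum
  with a paraboloid that lies below it on an inner and above it on an outer annulus.\<close>

lemma global_supersolution:
  assumes al: "0 < \<alpha>" "\<alpha> < 1/2"
  obtains w c where "c > 0" "supersolution (\<lambda>a b. c / cmod (lattice_point a b) ^ 3) w"
    "\<And>a b. b \<ge> 1 \<Longrightarrow> w a b \<le> cmod (lattice_point a b) powr (- \<alpha>)"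
proof -
  define rad where "rad a b = cmod (lattice_point a b)" for a b
  define v where "v = barrier \<alpha>"
  obtain R0 k where R0: "R0 \<ge> 4" and k: "0 < k" "k \<le> 1" and far0:
    "\<And>a b. b \<ge> 1 \<Longrightarrow> R0 \<le> rad a b \<Longrightarrow>
      k * rad a b powr (- \<alpha>) \<le> v a b \<and> v a b \<le> rad a b powr (- \<alpha>) \<and>
      1 / (4 * rad a b ^ 3) \<le> mixed_lap v a b"
    unfolding rad_def v_def by (rule barrier_far[OF al]) blast
  note far = far0[THEN conjunct1] far0[THEN conjunct2, THEN conjunct1] far0[THEN conjunct2, THEN conjunct2]
  \<comment> \<open>\<open>D\<close> bounds the barrier from below on R0 \<le> r < R0 + 1, and
    \<open>R1\<close> pushes it below D/4 for r \<ge> R1 - 1. With \<open>e\<close> as chosen, the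
    paraboloid lies between 3D/8 and D/2 on r < R1, hence below the barrier on the inner annulus and
    above it on the outer one.\<close>
  define D where "D = k * (R0 + 1) powr (- \<alpha>)"
  have D: "D > 0" using R0 k by (simp add: D_def)
  define R1 where "R1 = 2 + R0 + (4 / D) powr (1 / \<alpha>)"
  have R1: "R0 + 2 \<le> R1" "R1 > 0" using R0 by (auto simp: R1_def add_pos_nonneg)
  have R1D: "(R1 - 1) powr (- \<alpha>) \<le> D / 4"
  proof -
    have "(R1 - 1) powr (- \<alpha>) \<le> ((4 / D) powr (1 / \<alpha>)) powr (- \<alpha>)"
      using R0 D al by (intro powr_mono2') (auto simp: R1_def)
    also have "\<dots> = D / 4" using al D by (simp add: powr_powr powr_minus_divide)
    finally show ?thesis .
  qed
  define e where "e = D / (8 * R1^2)"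
  have e: "e > 0" "e * R1^2 = D / 8" using D R1 by (auto simp: e_def)
  define q where "q a b = e * (4 * R1^2 - rad a b ^ 2)" for a b
  have q_upper: "q a b \<le> D / 2" for a b
  proof -
    have "q a b \<le> e * (4 * R1^2)" unfolding q_def using e by (intro mult_left_mono) auto
    then show ?thesis using e by simp
  qed
  have q_lower: "3/8 * D \<le> q a b" if "rad a b < R1" for a b
  proof -
    have "rad a b ^ 2 \<le> R1^2" using that by (intro power_mono) (auto simp: rad_def)
    then have "e * (3 * R1^2) \<le> q a b" unfolding q_def using e by (intro mult_left_mono) auto
    then show ?thesis using e by simp
  qed
  have q_lap: "4 * e \<le> mixed_lap q a b" if "b \<ge> 1" "rad a b < R1" for a b
  proof -
    have mirror: "q a (1 - b) = q a b" for a b by (simp add: q_def rad_def lattice_point_mirror)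
    have "lap5 q a b = 4 * e"
      unfolding lap5_def q_def rad_def lattice_point_shift cmod_power2
      by (simp add: power2_sum power2_diff algebra_simps power_divide)
    then show ?thesis
      using that q_lower[OF that(2)] D by (auto simp: mixed_lap_even[of q, OF mirror])
  qed
  \<comment> \<open>The annuli have width 1 because a lattice step changes r by at most 1. So at
    every point one of q and v equals w there and dominates w at all neighbours.\<close>
  define w where "w a b = (if rad a b < R0 then q a b else if rad a b < R1 then min (v a b) (q a b) else v a b)" for a b
  have w_q: "w a b \<le> q a b" if "rad a b < R1" for a b
    using that by (auto simp: w_def)
  have w_v: "w a b \<le> v a b" if "R0 \<le> rad a b" for a b
    using that by (auto simp: w_def)
  have inner: "q a b \<le> v a b" if "b \<ge> 1" "R0 \<le> rad a b" "rad a b < R0 + 1" for a b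
  proof -
    have "D \<le> k * rad a b powr (- \<alpha>)"
      unfolding D_def using that k al R0 by (intro mult_left_mono powr_mono2') auto
    then show ?thesis using q_upper[of a b] far(1)[OF that(1,2)] D by linarith
  qed
  have outer: "v a b \<le> q a b" if "b \<ge> 1" "R1 - 1 \<le> rad a b" "rad a b < R1" for a b
  proof -
    have "R0 \<le> rad a b" using that R1 by simp
    then have "v a b \<le> rad a b powr (- \<alpha>)" using far(2) that by blast
    also have "\<dots> \<le> (R1 - 1) powr (- \<alpha>)" using that R1 R0 al by (intro powr_mono2') auto
    finally show ?thesis using R1D q_lower[OF that(3)] D by linarith
  qed
  \<comment> \<open>1/4 comes from the barrier; e/2 comes from the paraboloid, since r \<ge> 1/2
    gives 4 e r^3 \<ge> e/2.\<close>
  define c where "c = min (1/4) (e / 2)"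
  have super: "c / rad a b ^ 3 \<le> mixed_lap w a b" if b: "b \<ge> 1" for a b
  proof -
    note nb = norm_lattice_point_shift[of a b, folded rad_def]
    have pos: "rad a b > 0" by (simp add: rad_def)
    have "(rad a b < R1 - 1 \<and> w a b = q a b) \<or> (R0 + 1 \<le> rad a b \<and> w a b = v a b)"
      using inner[OF b, of a] outer[OF b, of a] R1
      by (cases "R1 - 1 \<le> rad a b"; cases "rad a b < R0 + 1") (auto simp: w_def min_def)
    then show ?thesis
    proof (elim disjE conjE)
      assume *: "rad a b < R1 - 1" "w a b = q a b"
      have "mixed_lap q a b \<le> mixed_lap w a b"
        by (intro mixed_lap_mono_at w_q) (use nb * b in linarith)+
      then have "4 * e \<le> mixed_lap w a b" using q_lap[OF b, of a] * by simp
      moreover have "c / rad a b ^ 3 \<le> 4 * e"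
      proof -
        have "(1/2) ^ 3 \<le> rad a b ^ 3"
          using norm_lattice_point_ge_half by (intro power_mono) (auto simp: rad_def)
        then have "4 * e * (1/8) \<le> 4 * e * rad a b ^ 3" using e by (intro mult_left_mono) (auto simp: power3_eq_cube)
        then have "c \<le> 4 * e * rad a b ^ 3" by (simp add: c_def)
        then show ?thesis using pos by (simp add: pos_divide_le_eq)
      qed
      ultimately show ?thesis by linarith
    next
      assume *: "R0 + 1 \<le> rad a b" "w a b = v a b"
      have "mixed_lap v a b \<le> mixed_lap w a b"
        by (intro mixed_lap_mono_at w_v) (use nb * b in linarith)+
      moreover have "1 / (4 * rad a b ^ 3) \<le> mixed_lap v a b" using far(3)[OF b] * by simp
      moreover have "c / rad a b ^ 3 \<le> (1/4) / rad a b ^ 3"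
        using pos by (intro divide_right_mono) (auto simp: c_def)
      ultimately show ?thesis by simp
    qed
  qed
  have nonneg: "0 \<le> w a b" if b: "b \<ge> 1" for a b
  proof -
    have "0 \<le> v a b" if "R0 \<le> rad a b"
      using far(1)[OF b that] k by (smt (verit) mult_nonneg_nonneg powr_ge_zero)
    moreover have "0 \<le> q a b" if "rad a b < R1" using q_lower[OF that] D by simp
    ultimately show ?thesis using R1 by (auto simp: w_def)
  qed
  have upper: "w a b \<le> rad a b powr (- \<alpha>)" if b: "b \<ge> 1" for a b
  proof (cases "R0 \<le> rad a b")
    case True
    then show ?thesis using w_v far(2)[OF b] order_trans by blast
  next
    case False
    have pos: "rad a b > 0" by (simp add: rad_def)
    have "w a b \<le> D / 2" using False q_upper by (simp add: w_def)
    also have "\<dots> \<le> D" using D by simp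
    also have "\<dots> \<le> 1 * (R0 + 1) powr (- \<alpha>)" unfolding D_def using k by (intro mult_right_mono) auto
    also have "\<dots> \<le> rad a b powr (- \<alpha>)" using False pos al by (simp add: powr_mono2')
    finally show ?thesis .
  qed
  show thesis
  proof (rule that[of c w])
    show "c > 0" using e by (simp add: c_def)
    show "supersolution (\<lambda>a b. c / cmod (lattice_point a b) ^ 3) w"
      using super nonneg by (simp add: supersolution_def rad_def)
    show "w a b \<le> cmod (lattice_point a b) powr (- \<alpha>)" if "b \<ge> 1" for a b
      using upper[OF that] by (simp add: rad_def)
  qed
qed

section \<open>Decay of the gradient\<close>

lemma gradient_bound_at:
  fixes U :: "int \<Rightarrow> int \<Rightarrow> real" and R :: int and M F :: real
  assumes R: "R > 0"
    and M: "\<And>a b. \<bar>a - a0\<bar> \<le> R + 1 \<Longrightarrow> \<bar>b - b0\<bar> \<le> R + 1 \<Longrightarrow> \<bar>U a b\<bar> \<le> M"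
    and F: "\<And>a b. \<bar>a - a0\<bar> \<le> R \<Longrightarrow> \<bar>b - b0\<bar> \<le> R \<Longrightarrow> \<bar>lap5 U a b\<bar> \<le> F"
  shows "\<bar>U (a0 + 1) b0 - U a0 b0\<bar> \<le> 2 * M / R + R * F"
    "\<bar>U (a0 - 1) b0 - U a0 b0\<bar> \<le> 2 * M / R + R * F"
    "\<bar>U a0 (b0 + 1) - U a0 b0\<bar> \<le> 2 * M / R + R * F"
    "\<bar>U a0 (b0 - 1) - U a0 b0\<bar> \<le> 2 * M / R + R * F"
proof -
  have minus: "a - (i + 1) = a - i - 1" "a - (i - 1) = a - i + 1" for a i :: int by auto
  have lap: "lap5 (\<lambda>i j. U (a0 + i) (b0 + j)) i j = lap5 U (a0 + i) (b0 + j)"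
    "lap5 (\<lambda>i j. U (a0 - i) (b0 + j)) i j = lap5 U (a0 - i) (b0 + j)"
    "lap5 (\<lambda>i j. U (a0 + j) (b0 + i)) i j = lap5 U (a0 + j) (b0 + i)"
    "lap5 (\<lambda>i j. U (a0 + j) (b0 - i)) i j = lap5 U (a0 + j) (b0 - i)" for i j
    by (simp_all add: lap5_def minus add.assoc add_diff_eq)
  show "\<bar>U (a0 + 1) b0 - U a0 b0\<bar> \<le> 2 * M / R + R * F"
    using reflection_gradient_bound[OF R, of "\<lambda>i j. U (a0 + i) (b0 + j)" M F] M F by (simp add: lap)
  show "\<bar>U (a0 - 1) b0 - U a0 b0\<bar> \<le> 2 * M / R + R * F"
    using reflection_gradient_bound[OF R, of "\<lambda>i j. U (a0 - i) (b0 + j)" M F] M F by (simp add: lap)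
  show "\<bar>U a0 (b0 + 1) - U a0 b0\<bar> \<le> 2 * M / R + R * F"
    using reflection_gradient_bound[OF R, of "\<lambda>i j. U (a0 + j) (b0 + i)" M F] M F by (simp add: lap)
  show "\<bar>U a0 (b0 - 1) - U a0 b0\<bar> \<le> 2 * M / R + R * F"
    using reflection_gradient_bound[OF R, of "\<lambda>i j. U (a0 + j) (b0 - i)" M F] M F by (simp add: lap)
qed

text \<open>A reflection kept fixed throughout a box is the wrong one only in the two rows next to
  the axis, and there only on the other side of the tip.\<close>

lemma lap5_half_ext:
  assumes "flip = (a \<ge> 1) \<or> b \<notin> {0, 1}"
  shows "\<bar>lap5 (half_ext flip u) a b\<bar> = \<bar>mixed_lap u a (if b \<ge> 1 then b else 1 - b)\<bar>"
proof -
  have upper: "lap5 (half_ext flip u) a b = mixed_lap u a b" if "b \<ge> 1" "flip = (a \<ge> 1) \<or> b \<noteq> 1" for b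
    using that by (auto simp: mixed_lap_eq lap5_def half_ext_def)
  show ?thesis
  proof (cases "b \<ge> 1")
    case True
    then show ?thesis using assms by (auto simp: upper)
  next
    case False
    have "half_ext flip u a (1 - b) = (if flip then -1 else 1) * half_ext flip u a b" for a b
      by (auto simp: half_ext_def)
    from this[of _ b] this[of _ "b - 1"] this[of _ "b + 1"]
    have "lap5 (half_ext flip u) a (1 - b) = (if flip then -1 else 1) * lap5 (half_ext flip u) a b"
      by (auto simp: lap5_def algebra_simps)
    then have "\<bar>lap5 (half_ext flip u) a b\<bar> = \<bar>lap5 (half_ext flip u) a (1 - b)\<bar>"
      by (auto simp: abs_mult)
    also have "lap5 (half_ext flip u) a (1 - b) = mixed_lap u a (1 - b)"
      using False assms by (intro upper) auto
    finally show ?thesis using False by simp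
  qed
qed

lemma abs_half_ext: "\<bar>half_ext flip u a b\<bar> = \<bar>u a (if b \<ge> 1 then b else 1 - b)\<bar>"
  by (simp add: half_ext_def)

lemma norm_lattice_point_mirror: "cmod (lattice_point a (1 - b)) = cmod (lattice_point a b)"
  by (simp add: lattice_point_mirror)

text \<open>The reflection of \<open>u\<close> across the axis is odd right and even left of the crack tip; which one is
  used at a point depends on its first coordinate, and the box for the interior gradient estimate
  has a radius proportional to the distance from the tip.\<close>

lemma mixed_gradient_bound:
  fixes u :: "int \<Rightarrow> int \<Rightarrow> real"
  assumes al: "0 \<le> \<alpha>" "\<alpha> \<le> 1" and A: "A \<ge> 0" and B: "B \<ge> 0"
    and u: "\<And>a b. b \<ge> 1 \<Longrightarrow> \<bar>u a b\<bar> \<le> A * cmod (lattice_point a b) powr (- \<alpha>)"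
    and lap: "\<And>a b. b \<ge> 1 \<Longrightarrow> \<bar>mixed_lap u a b\<bar> \<le> B / cmod (lattice_point a b) ^ 3"
    and nb: "(a', b') \<in> {(a + 1, b), (a - 1, b), (a, b + 1), (a, b - 1)}"
    and b: "b \<ge> 1"
  shows "\<bar>half_ext (a \<ge> 1) u a' b' - half_ext (a \<ge> 1) u a b\<bar>
    \<le> (256 * A + 16 * B) * cmod (lattice_point a b) powr (- \<alpha> - 1)"
proof -
  define U where "U = half_ext (a \<ge> 1) u"
  define r where "r = cmod (lattice_point a b)"
  have U: "\<bar>U x y\<bar> \<le> A * cmod (lattice_point x y) powr (- \<alpha>)" for x y
    using u[of y x] u[of "1 - y" x] norm_lattice_point_mirror[of x y]
    by (auto simp: U_def abs_half_ext)
  show ?thesis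
  proof (cases "r < 8")
    case True
    \<comment> \<open>Near the tip the trivial bound 4A suffices: r^(-\<alpha>-1) \<ge> 8^(-2) =
      1/64, and 64 * 4 = 256.\<close>
    have U4: "\<bar>U x y\<bar> \<le> 2 * A" for x y
    proof -
      have "cmod (lattice_point x y) powr (- \<alpha>) \<le> (1/2) powr (- \<alpha>)"
        using al norm_lattice_point_ge_half by (intro powr_mono2') auto
      also have "\<dots> = 2 powr \<alpha>" by (simp add: powr_divide powr_minus_divide)
      also have "\<dots> \<le> 2 powr 1" using al by (intro powr_mono) auto
      finally have "A * cmod (lattice_point x y) powr (- \<alpha>) \<le> A * 2"
        using A by (intro mult_left_mono) auto
      then show ?thesis using U[of x y] by simp
    qed
    have "1 / 64 \<le> r powr (- \<alpha> - 1)"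
    proof -
      have "(1 / 64 :: real) = 8 powr (- 2)" using powr_minus_divide[of "8::real" 2] by simp
      also have "\<dots> \<le> 8 powr (- \<alpha> - 1)" using al by (intro powr_mono) auto
      also have "\<dots> \<le> r powr (- \<alpha> - 1)" using al True by (intro powr_mono2') (auto simp: r_def)
      finally show ?thesis .
    qed
    then have "(256 * A + 16 * B) * (1 / 64) \<le> (256 * A + 16 * B) * r powr (- \<alpha> - 1)"
      using A B by (intro mult_left_mono) auto
    moreover have "\<bar>U a' b' - U a b\<bar> \<le> 4 * A" using U4[of a' b'] U4[of a b] by linarith
    ultimately show ?thesis using B by (simp add: U_def r_def)
  next
    case False
    \<comment> \<open>For r \<ge> 8 this leaves r/8 \<le> R, and points of the box with radius R + 1
      keep distance at least r - 2 (R + 1) \<ge> r/4 from the tip.\<close>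
    define R where "R = \<lfloor>r / 4\<rfloor>"
    have R: "R > 0" "real_of_int R \<le> r / 4" "r / 8 \<le> real_of_int R"
      using False by (auto simp: R_def) linarith+
    have near: "r - 2 * k \<le> cmod (lattice_point x y)"
      if "\<bar>x - a\<bar> \<le> k" "\<bar>y - b\<bar> \<le> k" for x y k
    proof -
      have "cmod (lattice_point x y - lattice_point a b) \<le> \<bar>real_of_int (x - a)\<bar> + \<bar>real_of_int (y - b)\<bar>"
        using cmod_le[of "lattice_point x y - lattice_point a b"] by simp
      also have "\<dots> \<le> 2 * k" using that by linarith
      finally show ?thesis
        using norm_triangle_ineq2[of "lattice_point a b" "lattice_point x y"]
        by (simp add: r_def norm_minus_commute)
    qed
    have far: "r / 4 \<le> cmod (lattice_point x y)"
      if "\<bar>x - a\<bar> \<le> R + 1" "\<bar>y - b\<bar> \<le> R + 1" for x y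
      using near[OF that] R False by simp
    define M where "M = A * (r / 4) powr (- \<alpha>)"
    define F where "F = B / (r / 4) ^ 3"
    have UM: "\<bar>U x y\<bar> \<le> M" if "\<bar>x - a\<bar> \<le> R + 1" "\<bar>y - b\<bar> \<le> R + 1" for x y
    proof -
      have "A * cmod (lattice_point x y) powr (- \<alpha>) \<le> M"
        unfolding M_def using A al False far[OF that] by (intro mult_left_mono powr_mono2') auto
      then show ?thesis using U[of x y] by linarith
    qed
    have UF: "\<bar>lap5 U x y\<bar> \<le> F" if "\<bar>x - a\<bar> \<le> R" "\<bar>y - b\<bar> \<le> R" for x y
    proof -
      \<comment> \<open>A box reaching both the rows next to the axis and the other side of the tip
        would force r \<le> 2R + 1 \<le> r/2 + 1, which contradicts r \<ge> 8.\<close>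
      have "(a \<ge> 1) = (x \<ge> 1) \<or> y \<notin> {0, 1}"
      proof (rule ccontr)
        assume "\<not> ?thesis"
        then have "\<bar>real_of_int a - 1/2\<bar> + \<bar>real_of_int b - 1/2\<bar> \<le> 2 * R + 1"
          using that b by (auto split: if_splits simp: abs_if)
        then have "r \<le> 2 * R + 1"
          using cmod_le[of "lattice_point a b"] by (simp add: r_def)
        then show False using R False by linarith
      qed
      then have "\<bar>lap5 U x y\<bar> = \<bar>mixed_lap u x (if y \<ge> 1 then y else 1 - y)\<bar>"
        unfolding U_def by (rule lap5_half_ext)
      also have "\<dots> \<le> B / cmod (lattice_point x (if y \<ge> 1 then y else 1 - y)) ^ 3"
        by (intro lap) auto
      also have "\<dots> = B / cmod (lattice_point x y) ^ 3"
        by (simp add: norm_lattice_point_mirror)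
      also have "\<dots> \<le> F"
        unfolding F_def using far[of x y] that B False
        by (intro divide_left_mono power_mono mult_pos_pos zero_less_power) auto
      finally show ?thesis .
    qed
    have "\<bar>U a' b' - U a b\<bar> \<le> 2 * M / R + R * F"
      using nb gradient_bound_at[OF R(1) UM UF] by auto
    also have "2 * M / R \<le> 64 * A * r powr (- \<alpha> - 1)"
    proof -
      have "M = A * (4 powr \<alpha> * r powr (- \<alpha>))"
        using False by (simp add: M_def powr_divide powr_minus field_simps)
      also have "\<dots> \<le> A * (4 * r powr (- \<alpha>))"
        using A al powr_mono[of \<alpha> 1 4] by (intro mult_left_mono mult_right_mono) auto
      finally have M4: "M \<le> 4 * A * r powr (- \<alpha>)" by simp
      have "0 \<le> M" using A by (simp add: M_def)
      then have "2 * M / R \<le> 2 * M / (r / 8)"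
        using R False by (intro divide_left_mono mult_pos_pos) auto
      also have "\<dots> = 16 * M / r" by simp
      also have "\<dots> \<le> 16 * (4 * A * r powr (- \<alpha>)) / r"
        using M4 False by (intro divide_right_mono) auto
      also have "\<dots> = 64 * A * r powr (- \<alpha> - 1)"
        using False by (simp add: powr_diff)
      finally show ?thesis .
    qed
    also have "R * F \<le> 16 * B * r powr (- \<alpha> - 1)"
    proof -
      have "R * F \<le> r / 4 * F" using R B False by (intro mult_right_mono) (auto simp: F_def)
      also have "\<dots> = 16 * B * r powr (- 2)"
        using False powr_minus_divide[of r 2] by (simp add: F_def field_simps power2_eq_square power3_eq_cube)
      also have "\<dots> \<le> 16 * B * r powr (- \<alpha> - 1)"
        using B False al by (intro mult_left_mono powr_mono) auto
      finally show ?thesis .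
    qed
    also have "64 * A * r powr (- \<alpha> - 1) + 16 * B * r powr (- \<alpha> - 1)
        \<le> (256 * A + 16 * B) * r powr (- \<alpha> - 1)"
      using A by (simp add: algebra_simps mult_right_mono)
    finally show ?thesis by (simp add: U_def r_def)
  qed
qed

section \<open>The corrector\<close>

definition lat :: "int \<Rightarrow> int \<Rightarrow> real \<times> real" where
  "lat a b = (a - 1/2, b - 1/2)"

lemma half_lattice_eq: "half_lattice = {lat a b | a b. True}"
  by (simp add: half_lattice_def lat_def)

lemma norm_lat: "norm (lat a b) = cmod (lattice_point a b)"
  by (simp add: lat_def norm_prod_def lattice_point_def cmod_def)

lemma lat_shift:
  "lat a b + (1, 0) = lat (a + 1) b" "lat a b + (0, 1) = lat a (b + 1)"
  "lat a b + (-1, 0) = lat (a - 1) b" "lat a b + (0, -1) = lat a (b - 1)"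
  "lat a b - (1, 0) = lat (a - 1) b" "lat a b - (0, 1) = lat a (b - 1)"
  "lat a b - (-1, 0) = lat (a + 1) b" "lat a b - (0, -1) = lat a (b + 1)"
  by (simp_all add: lat_def)

lemma dirs_at_lat:
  "dirs_at (lat a b) = (if a \<le> 0 \<and> b = 1 then dirs - {(0, -1)}
    else if a \<le> 0 \<and> b = 0 then dirs - {(0, 1)} else dirs)"
proof -
  have "lat a b \<in> half_lattice" by (auto simp: half_lattice_eq)
  then have G: "lat a b \<in> Gamma_plus \<longleftrightarrow> a \<le> 0 \<and> b = 1" "lat a b \<in> Gamma_minus \<longleftrightarrow> a \<le> 0 \<and> b = 0"
    by (auto simp: Gamma_plus_def Gamma_minus_def lat_def)
  show ?thesis unfolding dirs_at_def G by auto
qed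

lemma discrete_grad_lat:
  "discrete_grad u (lat a b) (1, 0) = u (lat (a + 1) b) - u (lat a b)"
  "discrete_grad u (lat a b) (-1, 0) = u (lat (a - 1) b) - u (lat a b)"
  "discrete_grad u (lat a b) (0, 1) = (if a \<le> 0 \<and> b = 0 then 0 else u (lat a (b + 1)) - u (lat a b))"
  "discrete_grad u (lat a b) (0, -1) = (if a \<le> 0 \<and> b = 1 then 0 else u (lat a (b - 1)) - u (lat a b))"
  by (auto simp: discrete_grad_def dirs_at_lat lat_shift) (auto simp: dirs_def)

lemma sum_dirs: "(\<Sum>\<rho>\<in>dirs. g \<rho>) = g (1, 0) + g (0, 1) + g (-1, 0) + g (0, -1)"
  for g :: "real \<times> real \<Rightarrow> real"
  by (simp add: dirs_def)

text \<open>The factor 2 arises because Div D counts every bond in both directions. Oddness supplies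
  the Dirichlet value across the axis on the right; on the left the crossing bond is missing, which
  is the Neumann condition.\<close>

lemma discrete_div_grad_odd:
  assumes odd: "\<And>a b. u (lat a (1 - b)) = - u (lat a b)"
  shows "discrete_div (discrete_grad u) (lat a b) =
    (if b \<ge> 1 then -2 else 2) * mixed_lap (\<lambda>a b. u (lat a b)) a (if b \<ge> 1 then b else 1 - b)"
proof -
  have low: "u (lat a 0) = - u (lat a 1)" for a using odd[of a 1] by simp
  have upper: "discrete_div (discrete_grad u) (lat a b) = -2 * mixed_lap (\<lambda>a b. u (lat a b)) a b"
    if "b \<ge> 1" for a b
    using that by (auto simp: discrete_div_def sum_dirs lat_shift discrete_grad_lat mixed_lap_eq low)
  have mirror: "discrete_div (discrete_grad u) (lat a (1 - b)) = - discrete_div (discrete_grad u) (lat a b)"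
    if "b \<ge> 1" for a b
    using that odd[of "a + 1" b] odd[of "a - 1" b] odd[of a b] odd[of a "b + 1"] odd[of a "b - 1"]
    by (auto simp: discrete_div_def sum_dirs lat_shift discrete_grad_lat)
  show ?thesis
  proof (cases "b \<ge> 1")
    case False
    then show ?thesis using mirror[of "1 - b" a] upper[of "1 - b" a] by simp
  qed (simp add: upper)
qed

lemma discrete_grad_cmult: "discrete_grad (\<lambda>l. k * u l) m \<rho> = k * discrete_grad u m \<rho>"
  by (simp add: discrete_grad_def algebra_simps)

lemma discrete_div_cmult: "discrete_div (\<lambda>m \<rho>. k * g m \<rho>) m = k * discrete_div g m"
  by (simp add: discrete_div_def sum_distrib_left algebra_simps)

lemma H1dot_cmult:
  assumes "u \<in> H1dot" shows "(\<lambda>l. k * u l) \<in> H1dot"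
proof -
  have "(L2_set (discrete_grad (\<lambda>l. k * u l) m) dirs)\<^sup>2 = k\<^sup>2 * (L2_set (discrete_grad u m) dirs)\<^sup>2" for m
    by (simp add: L2_set_def discrete_grad_cmult power_mult_distrib sum_distrib_left[symmetric] sum_nonneg)
  then show ?thesis using assms by (simp add: H1dot_def summable_on_cmult_right)
qed

section \<open>Square summability over the lattice\<close>

lemma summable_half_integers: "(\<lambda>n::int. \<bar>n - 1/2\<bar> powr (- 5/4)) summable_on UNIV"
proof -
  define g where "g n = \<bar>real_of_int n - 1/2\<bar> powr (- 5/4)" for n :: int
  have "summable (\<lambda>k. real (Suc k) powr (- 5/4))"
    unfolding summable_Suc_iff[of "\<lambda>k. real k powr (- 5/4)"] summable_real_powr_iff by simp
  then have "summable (\<lambda>k. 4 * real (Suc k) powr (- 5/4))" by (rule summable_mult)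
  then have "summable (\<lambda>k. (real k + 1/2) powr (- 5/4))"
  proof (rule summable_comparison_test_ev[rotated], intro always_eventually allI)
    fix k
    have "(real k + 1/2) powr (- 5/4) \<le> (real (Suc k) / 2) powr (- 5/4)"
      by (intro powr_mono2') auto
    also have "\<dots> = 2 powr (5/4) * real (Suc k) powr (- 5/4)"
      by (simp add: powr_divide powr_minus field_simps)
    also have "\<dots> \<le> 4 * real (Suc k) powr (- 5/4)"
      using powr_mono[of "5/4" 2 "2::real"] by (intro mult_right_mono) auto
    finally show "norm ((real k + 1/2) powr (- 5/4)) \<le> 4 * real (Suc k) powr (- 5/4)" by simp
  qed
  then have nat: "(\<lambda>k. (real k + 1/2) powr (- 5/4)) summable_on UNIV"
    by (subst summable_on_UNIV_nonneg_real_iff) auto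
  have "g summable_on range (\<lambda>k. int k + 1)"
    using nat by (subst summable_on_reindex) (auto simp: inj_def g_def o_def add.commute)
  moreover have "g summable_on range (\<lambda>k. - int k)"
    using nat by (subst summable_on_reindex) (auto simp: inj_def g_def o_def abs_if add.commute)
  moreover have "range (\<lambda>k. int k + 1) \<inter> range (\<lambda>k. - int k) = {}" by auto
  ultimately have "g summable_on (range (\<lambda>k. int k + 1) \<union> range (\<lambda>k. - int k))"
    by (rule summable_on_Un_disjoint)
  moreover have "range (\<lambda>k. int k + 1) \<union> range (\<lambda>k. - int k) = UNIV"
  proof -
    have "n \<in> range (\<lambda>k. int k + 1) \<union> range (\<lambda>k. - int k)" for n
    proof (cases "n \<ge> 1")
      case True
      then have "n = int (nat (n - 1)) + 1" by simp
      then show ?thesis by blast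
    next
      case False
      then have "n = - int (nat (- n))" by simp
      then show ?thesis by blast
    qed
    then show ?thesis by blast
  qed
  ultimately show ?thesis by (simp add: g_def[abs_def])
qed

text \<open>From |x| |y| \<le> r^2 follows r^(-5/2) \<le> |x|^(-5/4) |y|^(-5/4), a product of two
  summable one-dimensional families.\<close>

lemma summable_half_lattice: "(\<lambda>m. norm m powr (- 5/2)) summable_on half_lattice"
proof -
  define g where "g n = \<bar>real_of_int n - 1/2\<bar> powr (- 5/4)" for n :: int
  have g: "g summable_on UNIV" using summable_half_integers by (simp add: g_def[abs_def])
  have gpos: "g n \<ge> 0" for n by (simp add: g_def)
  have "(\<lambda>p. g (fst p) * g (snd p)) summable_on UNIV"
  proof (rule nonneg_bounded_partial_sums_imp_summable_on)
    have "sum (\<lambda>p. g (fst p) * g (snd p)) X \<le> (infsum g UNIV)\<^sup>2" if "finite X" for X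
    proof -
      have "sum (\<lambda>p. g (fst p) * g (snd p)) X \<le> sum (\<lambda>p. g (fst p) * g (snd p)) (fst ` X \<times> snd ` X)"
        using that gpos by (intro sum_mono2) (auto simp: rev_image_eqI)
      also have "\<dots> = sum g (fst ` X) * sum g (snd ` X)"
        by (simp add: sum_product sum.cartesian_product case_prod_beta)
      also have "\<dots> \<le> infsum g UNIV * infsum g UNIV"
        using that g gpos by (intro mult_mono finite_sum_le_infsum sum_nonneg infsum_nonneg) auto
      finally show ?thesis by (simp add: power2_eq_square)
    qed
    then show "\<forall>\<^sub>F X in finite_subsets_at_top UNIV. sum (\<lambda>p. g (fst p) * g (snd p)) X \<le> (infsum g UNIV)\<^sup>2"
      by (auto simp: eventually_finite_subsets_at_top)
  qed (use gpos in auto)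
  then have "(\<lambda>p. norm (lat (fst p) (snd p)) powr (- 5/2)) summable_on UNIV"
  proof (rule summable_on_comparison_test)
    fix p :: "int \<times> int"
    define x where "x = \<bar>real_of_int (fst p) - 1/2\<bar>"
    define y where "y = \<bar>real_of_int (snd p) - 1/2\<bar>"
    have xy: "x > 0" "y > 0" using half_integer_nonzero by (auto simp: x_def y_def)
    have "x * y \<le> x^2 + y^2" using sum_squares_bound[of x y] mult_pos_pos[OF xy] unfolding mult.assoc by linarith
    also have "\<dots> = norm (lat (fst p) (snd p)) ^ 2" by (simp add: lat_def norm_prod_def x_def y_def)
    finally have "(norm (lat (fst p) (snd p)) ^ 2) powr (- 5/4) \<le> (x * y) powr (- 5/4)"
      using xy by (intro powr_mono2') auto
    also have "\<dots> = g (fst p) * g (snd p)" using xy by (simp add: powr_mult g_def x_def y_def)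
    also have "(norm (lat (fst p) (snd p)) ^ 2) powr (- 5/4) = norm (lat (fst p) (snd p)) powr (- 5/2)"
      by (simp add: norm_lat powr_powr powr_numeral[symmetric] del: powr_numeral)
    finally show "norm (lat (fst p) (snd p)) powr (- 5/2) \<le> g (fst p) * g (snd p)" .
  qed simp
  then have "(\<lambda>m. norm m powr (- 5/2)) summable_on range (\<lambda>p. lat (fst p) (snd p))"
    by (subst summable_on_reindex) (auto simp: inj_def lat_def o_def)
  moreover have "range (\<lambda>p. lat (fst p) (snd p)) = half_lattice"
    by (simp add: half_lattice_eq image_def split_paired_Ex)
  ultimately show ?thesis by simp
qed

text \<open>5/4 is the gradient exponent \<alpha> + 1 for \<alpha> = 1/4; its double 5/2 exceeds the
  planar threshold 2.\<close>

lemma H1dot_of_decay: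
  assumes "\<And>l. l \<in> half_lattice \<Longrightarrow> L2_set (discrete_grad u l) dirs \<le> c * norm l powr (- 5/4)"
  shows "u \<in> H1dot"
proof -
  have "(\<lambda>m. (L2_set (discrete_grad u m) dirs)\<^sup>2) summable_on half_lattice"
  proof (rule summable_on_comparison_test)
    show "(\<lambda>m. c\<^sup>2 * norm m powr (- 5/2)) summable_on half_lattice"
      using summable_half_lattice by (rule summable_on_cmult_right)
    fix l assume l: "l \<in> half_lattice"
    have "(L2_set (discrete_grad u l) dirs)\<^sup>2 \<le> (c * norm l powr (- 5/4))\<^sup>2"
      using assms[OF l] by (intro power_mono) auto
    also have "\<dots> = c\<^sup>2 * norm l powr (- 5/2)"
      by (simp add: power_mult_distrib power2_eq_square powr_add[symmetric])
    finally show "(L2_set (discrete_grad u l) dirs)\<^sup>2 \<le> c\<^sup>2 * norm l powr (- 5/2)" .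
  qed simp
  then show ?thesis by (simp add: H1dot_def)
qed

lemma crack_corrector:
  obtains u :: "real \<times> real \<Rightarrow> real" where
    "\<And>a b. u (lat a (1 - b)) = - u (lat a b)"
    "\<And>a b. b \<ge> 1 \<Longrightarrow> mixed_lap (\<lambda>a b. u (lat a b)) a b = - mixed_lap omega_lat a b"
    "\<And>\<alpha>. 0 < \<alpha> \<Longrightarrow> \<alpha> < 1/2 \<Longrightarrow> \<exists>c. \<forall>l\<in>half_lattice.
      \<bar>u l\<bar> \<le> c * norm l powr (- \<alpha>) \<and> L2_set (discrete_grad u l) dirs \<le> c * norm l powr (- \<alpha> - 1)"
proof -
  obtain B where B: "B > 0"
    "\<And>a b. b \<ge> 1 \<Longrightarrow> \<bar>mixed_lap omega_lat a b\<bar> \<le> B / cmod (lattice_point a b) ^ 3"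
    using mixed_lap_omega_lat by blast
  define f where "f a b = - mixed_lap omega_lat a b" for a b
  have barrier: "\<exists>v A. supersolution (\<lambda>a b. \<bar>f a b\<bar>) v \<and> A \<ge> 0 \<and>
      (\<forall>a b. b \<ge> 1 \<longrightarrow> v a b \<le> A * cmod (lattice_point a b) powr (- \<alpha>))"
    if al: "0 < \<alpha>" "\<alpha> < 1/2" for \<alpha>
  proof -
    obtain w c where c: "c > 0" and w: "supersolution (\<lambda>a b. c / cmod (lattice_point a b) ^ 3) w"
      and wle: "\<And>a b. b \<ge> 1 \<Longrightarrow> w a b \<le> cmod (lattice_point a b) powr (- \<alpha>)"
      by (rule global_supersolution[OF al]) blast
    have "\<bar>f a b\<bar> \<le> mixed_lap (\<lambda>a b. B / c * w a b) a b" if "b \<ge> 1" for a b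
    proof -
      have "\<bar>f a b\<bar> \<le> B / c * (c / cmod (lattice_point a b) ^ 3)"
        using B(2)[OF that] c by (simp add: f_def)
      also have "\<dots> \<le> B / c * mixed_lap w a b"
        using w that B c by (intro mult_left_mono) (auto simp: supersolution_def)
      finally show ?thesis by (simp only: mixed_lap_cmult)
    qed
    then have "supersolution (\<lambda>a b. \<bar>f a b\<bar>) (\<lambda>a b. B / c * w a b)"
      using w B c by (simp add: supersolution_def)
    moreover have "B / c * w a b \<le> B / c * cmod (lattice_point a b) powr (- \<alpha>)" if "b \<ge> 1" for a b
      using wle[OF that] B c by (intro mult_left_mono) auto
    ultimately show ?thesis using B c by (intro exI[of _ "\<lambda>a b. B / c * w a b"] exI[of _ "B / c"]) simp
  qed
  obtain v0 where "supersolution (\<lambda>a b. \<bar>f a b\<bar>) v0" using barrier[of "1/4"] by auto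
  then obtain G where G: "\<And>a b. b \<ge> 1 \<Longrightarrow> mixed_lap G a b = f a b"
    "\<And>v a b. supersolution (\<lambda>a b. \<bar>f a b\<bar>) v \<Longrightarrow> b \<ge> 1 \<Longrightarrow> \<bar>G a b\<bar> \<le> v a b"
    using mixed_lap_solution[of f] by blast
  \<comment> \<open>The ceiling recovers the index a from the coordinate a - 1/2; values off the
    lattice are irrelevant.\<close>
  define u where "u p = half_ext True G \<lceil>fst p\<rceil> \<lceil>snd p\<rceil>" for p :: "real \<times> real"
  have ceil: "\<lceil>real_of_int a - 1/2\<rceil> = a" for a by (simp add: ceiling_eq_iff)
  have u: "u (lat a b) = half_ext True G a b" for a b
    by (simp add: u_def lat_def ceil)
  show thesis
  proof (rule that[of u])
    show "u (lat a (1 - b)) = - u (lat a b)" for a b by (simp add: u half_ext_def)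
    show "mixed_lap (\<lambda>a b. u (lat a b)) a b = - mixed_lap omega_lat a b" if "b \<ge> 1" for a b
      using that G(1)[OF that, of a] by (auto simp: u f_def mixed_lap_eq half_ext_def)
    fix \<alpha> :: real assume al: "0 < \<alpha>" "\<alpha> < 1/2"
    obtain v A where v: "supersolution (\<lambda>a b. \<bar>f a b\<bar>) v" and A: "A \<ge> 0"
      and vle: "\<And>a b. b \<ge> 1 \<Longrightarrow> v a b \<le> A * cmod (lattice_point a b) powr (- \<alpha>)"
      using barrier[OF al] by blast
    have Gle: "\<bar>G a b\<bar> \<le> A * cmod (lattice_point a b) powr (- \<alpha>)" if "b \<ge> 1" for a b
      using G(2)[OF v that] vle[OF that] order_trans by blast
    have lapG: "\<bar>mixed_lap G a b\<bar> \<le> B / cmod (lattice_point a b) ^ 3" if "b \<ge> 1" for a b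
      using B(2)[OF that] by (simp add: G(1)[OF that] f_def)
    define K where "K = 256 * A + 16 * B"
    have K: "K \<ge> 0" using A B by (simp add: K_def)
    have grad: "\<bar>half_ext (a \<ge> 1) G a' b' - half_ext (a \<ge> 1) G a b\<bar> \<le> K * cmod (lattice_point a b) powr (- \<alpha> - 1)"
      if "(a', b') \<in> {(a + 1, b), (a - 1, b), (a, b + 1), (a, b - 1)}" "b \<ge> 1" for a b a' b'
      unfolding K_def using al A B Gle lapG that by (intro mixed_gradient_bound) auto
    \<comment> \<open>u is the odd extension, whereas \<open>grad\<close> uses the even one left of
      the tip. They differ only below the axis, and there the crossing bond is absent from the
      discrete gradient.\<close>
    have upper: "\<bar>discrete_grad u (lat a b) \<rho>\<bar> \<le> K * cmod (lattice_point a b) powr (- \<alpha> - 1)"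
      if "\<rho> \<in> dirs" "b \<ge> 1" for a b \<rho>
      using that grad[of "a + 1" b a b] grad[of "a - 1" b a b] grad[of a "b + 1" a b] grad[of a "b - 1" a b] K
      unfolding dirs_def by (auto simp: discrete_grad_lat u half_ext_def)
    have mirror: "\<bar>discrete_grad u (lat a b) \<rho>\<bar> \<le> K * cmod (lattice_point a b) powr (- \<alpha> - 1)"
      if "\<rho> \<in> dirs" "\<not> b \<ge> 1" for a b \<rho>
    proof -
      have odd: "u (lat a' b') = - u (lat a' (1 - b'))" for a' b' by (simp add: u half_ext_def)
      have "\<bar>discrete_grad u (lat a b) \<rho>\<bar> = \<bar>discrete_grad u (lat a (1 - b)) (fst \<rho>, - snd \<rho>)\<bar>"
        using that odd[of "a + 1" b] odd[of "a - 1" b] odd[of a b] odd[of a "b + 1"] odd[of a "b - 1"]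
        unfolding dirs_def by (auto simp: discrete_grad_lat)
      also have "\<dots> \<le> K * cmod (lattice_point a (1 - b)) powr (- \<alpha> - 1)"
        using that by (intro upper) (auto simp: dirs_def)
      finally show ?thesis by (simp add: norm_lattice_point_mirror)
    qed
    have "\<bar>u (lat a b)\<bar> \<le> (A + 4 * K) * norm (lat a b) powr (- \<alpha>) \<and>
      L2_set (discrete_grad u (lat a b)) dirs \<le> (A + 4 * K) * norm (lat a b) powr (- \<alpha> - 1)" for a b
    proof
      have "\<bar>u (lat a b)\<bar> \<le> A * norm (lat a b) powr (- \<alpha>)"
        using Gle[of b a] Gle[of "1 - b" a] norm_lattice_point_mirror[of a b]
        by (auto simp: u abs_half_ext norm_lat)
      also have "\<dots> \<le> (A + 4 * K) * norm (lat a b) powr (- \<alpha>)" using K by (intro mult_right_mono) auto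
      finally show "\<bar>u (lat a b)\<bar> \<le> (A + 4 * K) * norm (lat a b) powr (- \<alpha>)" .
      have "\<bar>discrete_grad u (lat a b) \<rho>\<bar> \<le> K * norm (lat a b) powr (- \<alpha> - 1)" if "\<rho> \<in> dirs" for \<rho>
        using upper[OF that] mirror[OF that] unfolding norm_lat by blast
      then have "(\<Sum>\<rho>\<in>dirs. \<bar>discrete_grad u (lat a b) \<rho>\<bar>) \<le> (\<Sum>\<rho>\<in>dirs. K * norm (lat a b) powr (- \<alpha> - 1))"
        by (rule sum_mono)
      then have "L2_set (discrete_grad u (lat a b)) dirs \<le> 4 * K * norm (lat a b) powr (- \<alpha> - 1)"
        using L2_set_le_sum_abs[of "discrete_grad u (lat a b)" dirs] unfolding sum_dirs by linarith
      also have "\<dots> \<le> (A + 4 * K) * norm (lat a b) powr (- \<alpha> - 1)" using A by (intro mult_right_mono) auto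
      finally show "L2_set (discrete_grad u (lat a b)) dirs \<le> (A + 4 * K) * norm (lat a b) powr (- \<alpha> - 1)" .
    qed
    then show "\<exists>c. \<forall>l\<in>half_lattice. \<bar>u l\<bar> \<le> c * norm l powr (- \<alpha>) \<and>
        L2_set (discrete_grad u l) dirs \<le> c * norm l powr (- \<alpha> - 1)"
      by (intro exI[of _ "A + 4 * K"]) (auto simp: half_lattice_eq)
  qed
qed

theorem proposition2p8:
  "\<exists>G1 :: real \<times> real \<Rightarrow> real \<times> real \<Rightarrow> real.
     discrete_geometry_predictor G1 \<and>
     (\<exists>(Gm :: real \<times> real \<Rightarrow> real) (Gs :: real \<times> real \<Rightarrow> real).
        (\<forall>m\<in>half_lattice. \<forall>s\<in>half_lattice. G1 m s = Gm m * Gs s) \<and>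
        (\<forall>s\<in>half_lattice. Gs s = -2 * omega2 s / norm s) \<and>
        Gm \<in> H1dot \<and>
        (\<forall>\<delta>>0. \<exists>c::real. \<forall>i\<in>{0, 1}. \<forall>l\<in>half_lattice.
            norm_D i Gm l \<le> c * norm l powr (-1/2 - real i + \<delta>)))"
proof -
  obtain u where odd: "\<And>a b. u (lat a (1 - b)) = - u (lat a b)"
    and lap: "\<And>a b. b \<ge> 1 \<Longrightarrow> mixed_lap (\<lambda>a b. u (lat a b)) a b = - mixed_lap omega_lat a b"
    and decay: "\<And>\<alpha>. 0 < \<alpha> \<Longrightarrow> \<alpha> < 1/2 \<Longrightarrow> \<exists>c. \<forall>l\<in>half_lattice.
      \<bar>u l\<bar> \<le> c * norm l powr (- \<alpha>) \<and> L2_set (discrete_grad u l) dirs \<le> c * norm l powr (- \<alpha> - 1)"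
    by (rule crack_corrector) blast
  define Gs where "Gs s = -2 * omega2 s / norm s" for s :: "real \<times> real"
  have omega: "(\<lambda>a b. omega2 (lat a b)) = omega_lat" by (simp add: omega_lat_def lat_def fun_eq_iff)
  have "omega2 (lat a (1 - b)) = - omega2 (lat a b)" for a b
    using omega_lat_mirror[of a b] by (simp add: omega_lat_def lat_def)
  then have div: "- discrete_div (discrete_grad u) m = discrete_div (discrete_grad omega2) m"
    if "m \<in> half_lattice" for m
    using that by (auto simp: half_lattice_eq discrete_div_grad_odd[of u, OF odd]
        discrete_div_grad_odd[of omega2] lap omega)
  obtain c where "\<forall>l\<in>half_lattice. L2_set (discrete_grad u l) dirs \<le> c * norm l powr (- 1/4 - 1)"
    using decay[of "1/4"] by auto
  then have H: "u \<in> H1dot" by (intro H1dot_of_decay[of u c]) simp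
  have "- discrete_div (discrete_grad (\<lambda>l. u l * Gs s)) m
      = (-2 * omega2 s / norm s) * discrete_div (discrete_grad omega2) m"
    if "m \<in> half_lattice" for m s
  proof -
    have eq: "discrete_div (discrete_grad (\<lambda>l. u l * Gs s)) m = Gs s * discrete_div (discrete_grad u) m"
      unfolding discrete_div_cmult[symmetric] discrete_grad_cmult[symmetric] by (simp add: mult.commute)
    show ?thesis unfolding eq div[OF that, symmetric] by (simp add: Gs_def)
  qed
  moreover have "(\<lambda>l. u l * Gs s) \<in> H1dot" for s
    using H1dot_cmult[OF H, of "Gs s"] by (simp add: mult.commute)
  ultimately have "discrete_geometry_predictor (\<lambda>m s. u m * Gs s)"
    unfolding discrete_geometry_predictor_def by blast
  moreover have "\<exists>c. \<forall>i\<in>{0, 1}. \<forall>l\<in>half_lattice. norm_D i u l \<le> c * norm l powr (-1/2 - real i + \<delta>)"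
    if "\<delta> > 0" for \<delta>
  proof -
    \<comment> \<open>The decay estimate needs \<alpha> = 1/2 - d in (0, 1/2), so a large \<delta>
      is cut down to 1/4. Returning to \<delta> costs the factor (1/2)^(d - \<delta>), because
      lattice points have norm at least 1/2 and d - \<delta> \<le> 0.\<close>
    define d where "d = min \<delta> (1/4)"
    have d: "0 < d" "d \<le> 1/4" "d \<le> \<delta>" using that by (auto simp: d_def)
    obtain c where c: "\<And>l. l \<in> half_lattice \<Longrightarrow> \<bar>u l\<bar> \<le> c * norm l powr (- (1/2 - d))"
      "\<And>l. l \<in> half_lattice \<Longrightarrow> L2_set (discrete_grad u l) dirs \<le> c * norm l powr (- (1/2 - d) - 1)"
      using decay[of "1/2 - d"] d by auto
    have "norm_D i u l \<le> \<bar>c\<bar> * (1/2) powr (d - \<delta>) * norm l powr (-1/2 - real i + \<delta>)"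
      if i: "i \<in> {0, 1}" and l: "l \<in> half_lattice" for i l
    proof -
      have half: "1/2 \<le> norm l"
        using l norm_lattice_point_ge_half by (auto simp: half_lattice_eq norm_lat)
      have "norm_D i u l \<le> c * norm l powr (-1/2 - real i + d)"
        using c[OF l] i by (auto simp: norm_D_def algebra_simps)
      also have "\<dots> \<le> \<bar>c\<bar> * norm l powr (-1/2 - real i + d)" by (intro mult_right_mono) auto
      also have "norm l powr (-1/2 - real i + d) = norm l powr (d - \<delta>) * norm l powr (-1/2 - real i + \<delta>)"
        by (simp add: powr_add[symmetric] algebra_simps)
      also have "\<bar>c\<bar> * (norm l powr (d - \<delta>) * norm l powr (-1/2 - real i + \<delta>))
          \<le> \<bar>c\<bar> * ((1/2) powr (d - \<delta>) * norm l powr (-1/2 - real i + \<delta>))"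
        using half d by (intro mult_left_mono mult_right_mono powr_mono2') auto
      finally show ?thesis by (simp add: mult.assoc)
    qed
    then show ?thesis by blast
  qed
  ultimately show ?thesis using H by (intro exI[of _ "\<lambda>m s. u m * Gs s"] conjI exI[of _ u] exI[of _ Gs]) (auto simp: Gs_def)
qed

end
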